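(* Let $M$ (men) and $W$ (women) be disjoint finite sets with $|M|=|W|$, and suppose all preference lists, of men and of women, are full (strict total orders of the entire opposite side, with being unmatched worse than any match). Then for every acyclical preference profile $\bar q=(q_w)_{w\in W}$ for $W$ over $M$, the $M$-optimal stable matching rule $C^{\bar q}$, which maps each profile $\bar p=(p_m)_{m\in M}$ of full preference lists of the men to the $M$-optimal stable matching with respect to $\bar p$ and $\bar q$, is OSP-implementable.
   Context: Let $\mathcal F(W)$ be the set of full preference lists over $W$, i.e. strict total orders of $W$, and $\mathcal F(M)$ the analogous set for $M$. Each $p_m\in\mathcal F(W)$ is the preference list of man $m$, each $q_w\in\mathcal F(M)$ that of woman $w$; every participant prefers being matched to anyone over being unmatched. Write $w\succ_m w'$ if $m$ strictly prefers $w$ over $w'$ and $w\succeq_m w'$ if not $w'\succ_m w$ (being unmatched is ranked below all women); similarly for women. Acyclicality: a profile $\bar q\in\mathcal F(M)^W$ is cyclical if there exist $a,b,c\in M$ and $x,y\in W$ with $a\succ_x b\succ_x c\succ_y a$ (i.e. $x$ prefers $a$ to $b$ to $c$, and $y$ prefers $c$ to $a$). It is acyclical if it is not cyclical. A matching is a one-to-one mapping between a subset of $M$ and a subset of $W$; $\mathcal M$ is the set of matchings; $\mu_a$ is the match of participant $a$ in $\mu$, with $\mu_a=a$ if $a$ is unmatched. A matching is stable with respect to $\bar p,\bar q$ if there are no man $m$ and woman $w$ each preferring the other over the partner (if any) matched to them by $\mu$. The $M$-optimal stable matching is the stable matching (it exists, by Gale and Shapley) that every man weakly prefers to every other stable matching.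 A (one-side-querying) matching rule here is a function $C:\mathcal F(W)^M\to\mathcal M$; $C_m(\bar p)$ denotes the match of $m$ in $C(\bar p)$. A (one-side-querying, extensive-form) matching mechanism $\mathcal I$ consists of: (1) a finite rooted tree $T$ with edges directed away from the root; (2) a map $X$ from leaves of $T$ to $\mathcal M$; (3) a map $Q$ from internal nodes of $T$ to $M$; (4) a map $A$ from edges of $T$ to nonempty subsets of $\mathcal F(W)$ such that the sets on distinct edges outgoing from the same node are disjoint, and the union of the sets on the edges outgoing from a node $n$ equals the set $A(e)$ for the last edge $e$, along the path from the root to $n$, that is outgoing from a node $n'$ with $Q(n')=Q(n)$, or equals $\mathcal F(W)$ if there is no such edge. A profile $\bar p\in\mathcal F(W)^M$ passes through a node $n$ if for every edge $e$ on the path from the root to $n$, with source node $n'$, $p_{Q(n')}\in A(e)$. The matching rule $C^{\mathcal I}$ implemented by $\mathcal I$ maps $\bar p$ to $X(n)$, where $n$ is the unique leaf through which $\bar p$ passes. Two lists $p,p'$ diverge at a node $n$ if there are distinct edges $e,e'$ outgoing from $n$ with $p\in A(e)$, $p'\in A(e')$. $\mathcal I$ is obviously strategy-proof (OSP) for $m\in M$ if for every node $n$ with $Q(n)=m$ and all profiles $\bar p,\bar p'$ that both pass through $n$ such that $p_m$ and $p'_m$ diverge at $n$, $C^{\mathcal I}_m(\bar p)\succeq_m C^{\mathcal I}_m(\bar p')$ according to $p_m$. $\mathcal I$ is OSP if it is OSP for every $m\in M$. A matching rule $C$ is OSP-implementable if $C=C^{\mathcal I}$ for some OSP matching mechanism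 $\mathcal I$. *)

theory Defs
  imports Main "HOL-Library.FuncSet"
begin

text \<open>
  A preference list is a strict total order \<open>r\<close>; \<open>(x, y) \<in> r\<close> means that \<open>x\<close> is ranked strictly
  above \<open>y\<close>. Lists are confined to \<open>A \<times> A\<close>, so that they are determined by the ranking of \<open>A\<close>.
\<close>

definition full_prefs :: "'a set \<Rightarrow> 'a rel set" where
  "full_prefs A = {r. r \<subseteq> A \<times> A \<and> strict_linear_order_on A r}"

definition profiles :: "'i set \<Rightarrow> 'a set \<Rightarrow> ('i \<Rightarrow> 'a rel) set" where
  "profiles I A = I \<rightarrow>\<^sub>E full_prefs A"

text \<open>The partner of a participant is an option value; \<open>None\<close> means being unmatched.\<close>

fun prefers :: "'a rel \<Rightarrow> 'a option \<Rightarrow> 'a option \<Rightarrow> bool" where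
  "prefers r (Some x) (Some y) \<longleftrightarrow> (x, y) \<in> r"
| "prefers r (Some x) None \<longleftrightarrow> True"
| "prefers r None y \<longleftrightarrow> False"

definition weakly_prefers :: "'a rel \<Rightarrow> 'a option \<Rightarrow> 'a option \<Rightarrow> bool" where
  "weakly_prefers r x y \<longleftrightarrow> \<not> prefers r y x"

definition cyclical :: "'m set \<Rightarrow> 'w set \<Rightarrow> ('w \<Rightarrow> 'm rel) \<Rightarrow> bool" where
  "cyclical M W q \<longleftrightarrow>
     (\<exists>a\<in>M. \<exists>b\<in>M. \<exists>c\<in>M. \<exists>x\<in>W. \<exists>y\<in>W. (a, b) \<in> q x \<and> (b, c) \<in> q x \<and> (c, a) \<in> q y)"

abbreviation acyclical :: "'m set \<Rightarrow> 'w set \<Rightarrow> ('w \<Rightarrow> 'm rel) \<Rightarrow> bool" where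
  "acyclical M W q \<equiv> \<not> cyclical M W q"

type_synonym ('m, 'w) matching = "'m \<rightharpoonup> 'w"

definition matchings :: "'m set \<Rightarrow> 'w set \<Rightarrow> ('m, 'w) matching set" where
  "matchings M W = {\<mu>. dom \<mu> \<subseteq> M \<and> ran \<mu> \<subseteq> W \<and> inj_on \<mu> (dom \<mu>)}"

definition partner_of_woman :: "('m, 'w) matching \<Rightarrow> 'w \<Rightarrow> 'm option" where
  "partner_of_woman \<mu> w =
     (if w \<in> ran \<mu> then Some (THE m. \<mu> m = Some w) else None)"

definition stable ::
  "'m set \<Rightarrow> 'w set \<Rightarrow> ('m \<Rightarrow> 'w rel) \<Rightarrow> ('w \<Rightarrow> 'm rel) \<Rightarrow> ('m, 'w) matching \<Rightarrow> bool" where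
  "stable M W p q \<mu> \<longleftrightarrow>
     \<not> (\<exists>m\<in>M. \<exists>w\<in>W. prefers (p m) (Some w) (\<mu> m) \<and>
                     prefers (q w) (Some m) (partner_of_woman \<mu> w))"

definition M_optimal_stable ::
  "'m set \<Rightarrow> 'w set \<Rightarrow> ('m \<Rightarrow> 'w rel) \<Rightarrow> ('w \<Rightarrow> 'm rel) \<Rightarrow> ('m, 'w) matching \<Rightarrow> bool" where
  "M_optimal_stable M W p q \<mu> \<longleftrightarrow>
     \<mu> \<in> matchings M W \<and> stable M W p q \<mu> \<and>
     (\<forall>\<nu>\<in>matchings M W. stable M W p q \<nu> \<longrightarrow> (\<forall>m\<in>M. weakly_prefers (p m) (\<mu> m) (\<nu> m)))"

type_synonym ('m, 'w) rule = "('m \<Rightarrow> 'w rel) \<Rightarrow> ('m, 'w) matching"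

text \<open>
  For finite \<open>M\<close> and \<open>W\<close> and full profiles, the description below is proper: existence is the theorem
  of Gale and Shapley, and uniqueness holds because preferences are strict.
\<close>

definition M_optimal_rule :: "'m set \<Rightarrow> 'w set \<Rightarrow> ('w \<Rightarrow> 'm rel) \<Rightarrow> ('m, 'w) rule" where
  "M_optimal_rule M W q p = (THE \<mu>. M_optimal_stable M W p q \<mu>)"

definition rooted_tree :: "'n set \<Rightarrow> 'n rel \<Rightarrow> 'n \<Rightarrow> bool" where
  "rooted_tree V E r \<longleftrightarrow>
     r \<in> V \<and> E \<subseteq> V \<times> V \<and>
     (\<forall>u. (u, r) \<notin> E) \<and>
     (\<forall>v\<in>V - {r}. \<exists>!u. (u, v) \<in> E) \<and>
     (\<forall>v\<in>V. (r, v) \<in> E\<^sup>*)"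

text \<open>
  The values of \<open>outcome\<close> (\<open>X\<close>) off the leaves, of \<open>query\<close> (\<open>Q\<close>) off the internal nodes and of
  \<open>answers\<close> (\<open>A\<close>) off the edges are irrelevant.
\<close>

record ('n, 'm, 'w) mechanism =
  nodes :: "'n set"
  edges :: "'n rel"
  root :: 'n
  outcome :: "'n \<Rightarrow> ('m, 'w) matching"
  query :: "'n \<Rightarrow> 'm"
  answers :: "'n \<times> 'n \<Rightarrow> 'w rel set"

definition out_edges :: "('n, 'm, 'w) mechanism \<Rightarrow> 'n \<Rightarrow> 'n rel" where
  "out_edges I n = {e \<in> edges I. fst e = n}"

definition leaves :: "('n, 'm, 'w) mechanism \<Rightarrow> 'n set" where
  "leaves I = {n \<in> nodes I. out_edges I n = {}}"

definition internal_nodes :: "('n, 'm, 'w) mechanism \<Rightarrow> 'n set" where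
  "internal_nodes I = nodes I - leaves I"

text \<open>
  In a rooted tree, an edge lies on the path from the root to \<open>n\<close> iff \<open>n\<close> is reachable from its
  target, and of two edges on that path, the later one is the one whose target is reachable from
  the target of the other.
\<close>

definition path_edges :: "('n, 'm, 'w) mechanism \<Rightarrow> 'n \<Rightarrow> 'n rel" where
  "path_edges I n = {e \<in> edges I. (snd e, n) \<in> (edges I)\<^sup>*}"

definition last_same_query :: "('n, 'm, 'w) mechanism \<Rightarrow> 'n \<Rightarrow> 'n \<times> 'n \<Rightarrow> bool" where
  "last_same_query I n e \<longleftrightarrow>
     e \<in> path_edges I n \<and> query I (fst e) = query I n \<and>
     (\<forall>e'\<in>path_edges I n. query I (fst e') = query I n \<longrightarrow> (snd e', snd e) \<in> (edges I)\<^sup>*)"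

definition matching_mechanism :: "'m set \<Rightarrow> 'w set \<Rightarrow> ('n, 'm, 'w) mechanism \<Rightarrow> bool" where
  "matching_mechanism M W I \<longleftrightarrow>
     finite (nodes I) \<and> rooted_tree (nodes I) (edges I) (root I) \<and>
     (\<forall>n\<in>leaves I. outcome I n \<in> matchings M W) \<and>
     (\<forall>n\<in>internal_nodes I. query I n \<in> M) \<and>
     (\<forall>e\<in>edges I. answers I e \<noteq> {} \<and> answers I e \<subseteq> full_prefs W) \<and>
     (\<forall>n\<in>internal_nodes I.
        (\<forall>e\<in>out_edges I n. \<forall>e'\<in>out_edges I n. e \<noteq> e' \<longrightarrow> answers I e \<inter> answers I e' = {}) \<and>
        (\<forall>e. last_same_query I n e \<longrightarrow> (\<Union>e'\<in>out_edges I n. answers I e') = answers I e) \<and>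
        ((\<nexists>e. last_same_query I n e) \<longrightarrow> (\<Union>e'\<in>out_edges I n. answers I e') = full_prefs W))"

definition passes_through :: "('n, 'm, 'w) mechanism \<Rightarrow> ('m \<Rightarrow> 'w rel) \<Rightarrow> 'n \<Rightarrow> bool" where
  "passes_through I p n \<longleftrightarrow> (\<forall>e\<in>path_edges I n. p (query I (fst e)) \<in> answers I e)"

definition implemented_rule :: "('n, 'm, 'w) mechanism \<Rightarrow> ('m, 'w) rule" where
  "implemented_rule I p = outcome I (THE n. n \<in> leaves I \<and> passes_through I p n)"

definition diverge_at :: "('n, 'm, 'w) mechanism \<Rightarrow> 'n \<Rightarrow> 'w rel \<Rightarrow> 'w rel \<Rightarrow> bool" where
  "diverge_at I n r r' \<longleftrightarrow>
     (\<exists>e\<in>out_edges I n. \<exists>e'\<in>out_edges I n. e \<noteq> e' \<and> r \<in> answers I e \<and> r' \<in> answers I e')"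

definition osp_for :: "'m set \<Rightarrow> 'w set \<Rightarrow> ('n, 'm, 'w) mechanism \<Rightarrow> 'm \<Rightarrow> bool" where
  "osp_for M W I m \<longleftrightarrow>
     (\<forall>n\<in>internal_nodes I. query I n = m \<longrightarrow>
        (\<forall>p\<in>profiles M W. \<forall>p'\<in>profiles M W.
           passes_through I p n \<and> passes_through I p' n \<and> diverge_at I n (p m) (p' m) \<longrightarrow>
           weakly_prefers (p m) (implemented_rule I p m) (implemented_rule I p' m)))"

definition osp :: "'m set \<Rightarrow> 'w set \<Rightarrow> ('n, 'm, 'w) mechanism \<Rightarrow> bool" where
  "osp M W I \<longleftrightarrow> (\<forall>m\<in>M. osp_for M W I m)"

text \<open>
  Trees are finite, so taking the nodes to be natural numbers is no restriction. A rule is a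
  function on \<open>profiles M W\<close> only, hence the bounded equality.
\<close>

definition osp_implementable :: "'m set \<Rightarrow> 'w set \<Rightarrow> ('m, 'w) rule \<Rightarrow> bool" where
  "osp_implementable M W C \<longleftrightarrow>
     (\<exists>I :: (nat, 'm, 'w) mechanism.
        matching_mechanism M W I \<and> osp M W I \<and> (\<forall>p\<in>profiles M W. C p = implemented_rule I p))"

end

theory Submission imports Defs "HOL-Library.Sublist" begin

text \<open>
  Acyclicality forces at most two men \<open>a\<close>, \<open>b\<close> to be ranked first by some remaining woman, and if
  there are two of them then every remaining woman ranks both above all other remaining men. A sole
  top man is asked for his favourite woman and gets her. With two top men, \<open>a\<close> is first asked only
  whether his favourite is some given woman who ranks him first; if so, he gets her. If not, \<open>b\<close> is
  asked for his favourite, whom he gets in any case: if she prefers \<open>b\<close>, they leave and \<open>a\<close> is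
  now ranked first by everyone, in particular by all the women he could have claimed before; if she
  prefers \<open>a\<close>, then neither man stands in the other's way and both get their favourites.
\<close>


text \<open>Obvious strategy-proofness sets the worst outcome of telling the truth against the best
  outcome of a lie, with the lists of the other men varying independently on both sides. This is why
  \<open>a\<close> cannot be asked for his favourite outright. Let y1 and y2 be two women who both
  rank \<open>b\<close> first. If the list of \<open>a\<close> starts with y1, y2 and
  \<open>b\<close> wants y1, then \<open>a\<close> gets y2; had he reported a list that starts with
  y2, y1, and had \<open>b\<close> wanted y2, he would have got y1. Pooling all lists whose
  favourite ranks \<open>b\<close> first postpones this distinction until \<open>b\<close> has
  answered, and then it is harmless. All but one of the comparisons follow one pattern: the man
  asked belongs to a set of men who get their favourites among the remaining women, and no report
  can give him anything but a remaining woman or nobody. The exception is the pooled answer of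
  \<open>a\<close> against a claim, when \<open>b\<close> then leaves first.\<close>

section \<open>Query strategies without trees: boxes of profiles\<close>

text \<open>\<open>P\<close> partitions what \<open>m\<close> may still answer. The profiles
  \<open>p\<close> and \<open>p'\<close> share only the box \<open>D\<close>: the other men's lists
  may differ, exactly as for two profiles that diverge at a node in \<open>osp_for\<close>.\<close>

definition obvious_query ::
  "'m set \<Rightarrow> ('m, 'w) rule \<Rightarrow> ('m \<Rightarrow> 'w rel set) \<Rightarrow> 'm \<Rightarrow> 'w rel set set \<Rightarrow> bool" where
  "obvious_query M C D m P \<longleftrightarrow>
     m \<in> M \<and> finite P \<and> P \<noteq> {} \<and> {} \<notin> P \<and> \<Union>P = D m \<and>
     (\<forall>S\<in>P. \<forall>S'\<in>P. S \<noteq> S' \<longrightarrow> S \<inter> S' = {} \<and>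
        (\<forall>p\<in>Pi\<^sub>E M (D(m := S)). \<forall>p'\<in>Pi\<^sub>E M (D(m := S')).
           weakly_prefers (p m) (C p m) (C p' m)))"

lemma obvious_query_disjoint:
  "obvious_query M C D m P \<Longrightarrow> S \<in> P \<Longrightarrow> S' \<in> P \<Longrightarrow> S \<noteq> S' \<Longrightarrow> S \<inter> S' = {}"
  unfolding obvious_query_def by blast

text \<open>A derivation is a finite query tree, since each \<open>P\<close> is finite. The matching
  argument therefore only has to supply queries and never touches nodes and edges.\<close>

inductive osp_solvable :: "'m set \<Rightarrow> ('m, 'w) rule \<Rightarrow> ('m \<Rightarrow> 'w rel set) \<Rightarrow> bool"
  for M C where
  const: "(\<And>p p'. p \<in> Pi\<^sub>E M D \<Longrightarrow> p' \<in> Pi\<^sub>E M D \<Longrightarrow> C p = C p') \<Longrightarrow> osp_solvable M C D"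
| query: "obvious_query M C D m P \<Longrightarrow> (\<And>S. S \<in> P \<Longrightarrow> osp_solvable M C (D(m := S))) \<Longrightarrow>
    osp_solvable M C D"

section \<open>From derivations to trees of histories\<close>

text \<open>
  Nodes of the tree are histories: lists of queried men, each with the set of lists he admits to.
  A box \<open>Pi\<^sub>E M D\<close> consists of the profiles that are compatible with what is known about each man.
\<close>

fun narrow :: "('m \<Rightarrow> 'w rel set) \<Rightarrow> ('m \<times> 'w rel set) list \<Rightarrow> 'm \<Rightarrow> 'w rel set" where
  "narrow D [] = D"
| "narrow D ((m, S) # h) = narrow (D(m := S)) h"

lemma narrow_snoc: "narrow D (h @ [(m, S)]) = (narrow D h)(m := S)"
  by (induction D h rule: narrow.induct) (simp_all del: fun_upd_apply)

definition branches :: "'a list set \<Rightarrow> 'a list \<Rightarrow> 'a set" where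
  "branches N h = {x. h @ [x] \<in> N}"

locale history_tree =
  fixes M :: "'m set" and C :: "('m, 'w) rule" and D :: "'m \<Rightarrow> 'w rel set"
    and N :: "('m \<times> 'w rel set) list set"
  assumes finite_N: "finite N"
    and Nil_in_N: "[] \<in> N"
    and N_snocD: "\<And>h x. h @ [x] \<in> N \<Longrightarrow> h \<in> N"
    and N_cases: "\<And>h. h \<in> N \<Longrightarrow>
      (branches N h = {} \<and>
         (\<forall>p\<in>Pi\<^sub>E M (narrow D h). \<forall>p'\<in>Pi\<^sub>E M (narrow D h). C p = C p')) \<or>
      (\<exists>m P. branches N h = Pair m ` P \<and> obvious_query M C (narrow D h) m P)"

text \<open>A query puts \<open>(m, S)\<close> in front of every history of the subtree for
  \<open>S\<close>. Narrowing starts at the front of a history, so below this entry it works on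
  \<open>D(m := S)\<close>, and the conditions of the subtree carry over unchanged.\<close>

lemma osp_solvable_history_tree:
  assumes "osp_solvable M C D"
  shows "\<exists>N. history_tree M C D N"
  using assms
proof (induction rule: osp_solvable.induct)
  case (const D)
  have "history_tree M C D {[]}"
  proof
    show "(branches {[]} h = {} \<and>
         (\<forall>p\<in>Pi\<^sub>E M (narrow D h). \<forall>p'\<in>Pi\<^sub>E M (narrow D h). C p = C p')) \<or>
      (\<exists>m P. branches {[]} h = Pair m ` P \<and> obvious_query M C (narrow D h) m P)"
      if "h \<in> {[]}" for h
    proof (rule disjI1, intro conjI ballI)
      show "branches {[]} h = {}" by (auto simp: branches_def)
      fix p p' assume "p \<in> Pi\<^sub>E M (narrow D h)" "p' \<in> Pi\<^sub>E M (narrow D h)"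
      moreover have "narrow D h = D" using that by simp
      ultimately show "C p = C p'" using const by metis
    qed
  qed auto
  then show ?case by blast
next
  case (query D m P)
  obtain T where T: "\<And>S. S \<in> P \<Longrightarrow> history_tree M C (D(m := S)) (T S)"
    using query.IH by metis
  define N where "N = insert [] (\<Union>S\<in>P. Cons (m, S) ` T S)"
  have br_Nil: "branches N [] = Pair m ` P"
    using history_tree.Nil_in_N[OF T] by (auto simp: branches_def N_def)
  have br_Cons: "branches N ((m, S) # h) = branches (T S) h" if "S \<in> P" for S h
    using that by (auto simp: branches_def N_def)
  have "history_tree M C D N"
  proof
    show "finite N"
      using query.hyps(1) history_tree.finite_N[OF T] by (auto simp: N_def obvious_query_def)
    show "[] \<in> N" by (simp add: N_def)
    show "h \<in> N" if hx: "h @ [x] \<in> N" for h x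
    proof (cases h)
      case Nil then show ?thesis by (simp add: N_def)
    next
      case (Cons y g)
      then obtain S where S: "S \<in> P" "y = (m, S)" "g @ [x] \<in> T S"
        using hx by (auto simp: N_def)
      then show ?thesis
        using history_tree.N_snocD[OF T[OF S(1)] S(3)] Cons by (auto simp: N_def)
    qed
    fix h assume "h \<in> N"
    then consider "h = []" | S g where "S \<in> P" "h = (m, S) # g" "g \<in> T S"
      by (auto simp: N_def)
    then show "(branches N h = {} \<and>
         (\<forall>p\<in>Pi\<^sub>E M (narrow D h). \<forall>p'\<in>Pi\<^sub>E M (narrow D h). C p = C p')) \<or>
      (\<exists>m P. branches N h = Pair m ` P \<and> obvious_query M C (narrow D h) m P)"
    proof cases
      case 1
      then show ?thesis using br_Nil query.hyps(1) by auto
    next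
      case 2
      then show ?thesis
        using history_tree.N_cases[OF T[OF 2(1)] 2(3)] by (simp add: br_Cons)
    qed
  qed
  then show ?case by blast
qed

context history_tree
begin

lemma N_prefix: "h' \<in> N \<Longrightarrow> prefix h h' \<Longrightarrow> h \<in> N"
proof (induction h' rule: rev_induct)
  case (snoc x h')
  then show ?case using N_snocD by (auto simp: prefix_snoc)
qed simp

lemma N_snoc_query:
  assumes "h @ [(m, S)] \<in> N"
  obtains P where "branches N h = Pair m ` P" "obvious_query M C (narrow D h) m P" "S \<in> P"
proof -
  have "(m, S) \<in> branches N h" using assms by (simp add: branches_def)
  then show thesis using N_cases[OF N_snocD[OF assms]] that by auto
qed

text \<open>\<open>narrow\<close> overwrites the set of \<open>m\<close>; as the new set is part of
  the old one, overwriting amounts to intersecting.\<close>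

lemma box_snoc:
  assumes "h @ [(m, S)] \<in> N"
  shows "p \<in> Pi\<^sub>E M (narrow D (h @ [(m, S)])) \<longleftrightarrow> p \<in> Pi\<^sub>E M (narrow D h) \<and> p m \<in> S"
proof -
  obtain P where "obvious_query M C (narrow D h) m P" "S \<in> P"
    using N_snoc_query[OF assms] .
  then have "m \<in> M" "S \<subseteq> narrow D h m" by (auto simp: obvious_query_def)
  then show ?thesis
    by (auto simp: narrow_snoc PiE_iff split: if_splits)
qed

lemma box_subset: "h \<in> N \<Longrightarrow> Pi\<^sub>E M (narrow D h) \<subseteq> Pi\<^sub>E M D"
proof (induction h rule: rev_induct)
  case (snoc x h)
  then show ?case using box_snoc[of h "fst x" "snd x"] N_snocD by auto
qed simp

text \<open>Histories that part company do so at a common node, with disjoint answer sets for one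
  and the same man, and \<open>p m\<close> cannot lie in both.\<close>

lemma boxes_comparable:
  assumes "p \<in> Pi\<^sub>E M (narrow D h)" "p \<in> Pi\<^sub>E M (narrow D h')" "h \<in> N" "h' \<in> N"
  shows "prefix h h' \<or> prefix h' h"
  using assms(1,3)
proof (induction h rule: rev_induct)
  case (snoc x h)
  obtain m S where x: "x = (m, S)" by (cases x)
  obtain P where P: "branches N h = Pair m ` P" "obvious_query M C (narrow D h) m P" "S \<in> P"
    using N_snoc_query snoc.prems x by metis
  have "p \<in> Pi\<^sub>E M (narrow D h)" and pS: "p m \<in> S"
    using box_snoc snoc.prems x by metis+
  then consider "prefix h' h" | y g where "h' = h @ y # g"
    using snoc.IH N_snocD[OF snoc.prems(2)] by (metis append_Nil2 neq_Nil_conv prefixE prefix_order.refl)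
  then show ?case
  proof cases
    case 1
    then show ?thesis by (simp add: prefix_snoc)
  next
    case 2
    have hy: "h @ [y] \<in> N" using N_prefix[OF assms(4)] 2 by simp
    then obtain S' where S': "y = (m, S')" "S' \<in> P" using P(1) by (auto simp: branches_def)
    \<comment> \<open>Boxes shrink along a history, so the answer given at the split still
      constrains the box of \<open>h'\<close>.\<close>
    have "p m \<in> S'"
    proof -
      have "prefix (h @ [(m, S')]) g' \<Longrightarrow> g' \<in> N \<Longrightarrow> p \<in> Pi\<^sub>E M (narrow D g') \<Longrightarrow> p m \<in> S'" for g'
      proof (induction g' rule: rev_induct)
        case (snoc z g')
        then show ?case
          using box_snoc[of g' "fst z" "snd z"] N_snocD[of g' z] by (auto simp: prefix_snoc)
      qed simp
      from this[of h'] show ?thesis using 2 S'(1) assms(2,4) by simp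
    qed
    then have "S = S'" using pS P S' unfolding obvious_query_def by blast
    then show ?thesis using 2 S' x by simp
  qed
qed simp

text \<open>A longest history compatible with \<open>p\<close> is a leaf, because the answers at a
  query cover everything \<open>m\<close> may still say. Two compatible leaves are comparable, and a
  leaf has no proper extension.\<close>

lemma ex1_leaf_history:
  assumes "p \<in> Pi\<^sub>E M D"
  shows "\<exists>!h. h \<in> N \<and> branches N h = {} \<and> p \<in> Pi\<^sub>E M (narrow D h)"
proof -
  let ?H = "{h \<in> N. p \<in> Pi\<^sub>E M (narrow D h)}"
  have "[] \<in> ?H" using Nil_in_N assms by simp
  then have "finite ?H" "?H \<noteq> {}" using finite_N by (simp, metis empty_iff)
  then have "Max (length ` ?H) \<in> length ` ?H" by (intro Max_in) auto
  then obtain h where h: "h \<in> ?H" "length h = Max (length ` ?H)" by auto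
  have longest: "length g \<le> length h" if "g \<in> ?H" for g
    unfolding h(2) using that \<open>finite ?H\<close> by (intro Max_ge) auto
  have "branches N h = {}"
  proof (rule ccontr)
    assume "branches N h \<noteq> {}"
    then obtain m P where P: "branches N h = Pair m ` P" "obvious_query M C (narrow D h) m P"
      using N_cases h(1) by blast
    then have "p m \<in> \<Union>P" using h(1) by (auto simp: obvious_query_def PiE_iff)
    then obtain S where "S \<in> P" "p m \<in> S" by blast
    then have "h @ [(m, S)] \<in> ?H"
      using h(1) P(1) box_snoc[of h m S] by (auto simp: branches_def)
    then show False using longest by fastforce
  qed
  moreover have "g = g'" if "g \<in> ?H" "g' \<in> ?H" "branches N g = {}" "branches N g' = {}" for g g'
  proof -
    have *: "u = v" if "prefix u v" "v \<in> N" "branches N u = {}" for u v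
    proof (rule ccontr)
      assume "u \<noteq> v"
      then obtain y ys where "v = u @ y # ys" using \<open>prefix u v\<close>
        by (metis append_Nil2 neq_Nil_conv prefixE)
      then have "u @ [y] \<in> N" using N_prefix[OF \<open>v \<in> N\<close>] by simp
      then have "y \<in> branches N u" by (simp add: branches_def)
      then show False using that(3) by simp
    qed
    then show ?thesis using boxes_comparable[of p g g'] that by auto
  qed
  ultimately show ?thesis using h(1) by blast
qed

end

section \<open>The mechanism whose nodes are numbered histories\<close>

locale encoded_history_tree = history_tree M C D N
  for M :: "'m set" and C :: "('m, 'w) rule" and D :: "'m \<Rightarrow> 'w rel set" and N +
  fixes enc :: "('m \<times> 'w rel set) list \<Rightarrow> nat"
  assumes inj_enc: "inj_on enc N"
begin

declare split_paired_Ex [simp del] split_paired_All [simp del]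

definition "dec = inv_into N enc"

text \<open>All branches at a node carry the same man, so any of them yields \<open>query\<close>.
  The default \<open>Map.empty\<close> is a matching in any case, so that boxes of leaves need not
  be shown to be nonempty.\<close>

definition "mech =
  \<lparr>nodes = enc ` N,
   edges = {(enc h, enc (h @ [x])) | h x. h @ [x] \<in> N},
   root = enc [],
   outcome = (\<lambda>n. if Pi\<^sub>E M (narrow D (dec n)) = {} then Map.empty
                   else C (SOME p. p \<in> Pi\<^sub>E M (narrow D (dec n)))),
   query = (\<lambda>n. fst (SOME x. x \<in> branches N (dec n))),
   answers = (\<lambda>e. snd (last (dec (snd e))))\<rparr>"

lemma dec_enc [simp]: "h \<in> N \<Longrightarrow> dec (enc h) = h"
  by (simp add: dec_def inj_enc)

lemma enc_eq_iff [simp]: "h \<in> N \<Longrightarrow> h' \<in> N \<Longrightarrow> enc h = enc h' \<longleftrightarrow> h = h'"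
  using inj_enc by (auto dest: inj_onD)

lemma nodes_mech [simp]: "nodes mech = enc ` N"
  and root_mech [simp]: "root mech = enc []"
  by (simp_all add: mech_def)

lemma edges_mech: "(u, v) \<in> edges mech \<longleftrightarrow> (\<exists>h x. h @ [x] \<in> N \<and> u = enc h \<and> v = enc (h @ [x]))"
  by (auto simp: mech_def)

lemma edge_mechE:
  assumes "(u, v) \<in> edges mech"
  obtains h x where "h @ [x] \<in> N" "h \<in> N" "u = enc h" "v = enc (h @ [x])"
  using assms N_snocD unfolding edges_mech by metis

lemma edge_mech: "h @ [x] \<in> N \<Longrightarrow> (enc h, enc (h @ [x])) \<in> edges mech"
  by (auto simp: mech_def)

lemma query_mech [simp]:
  assumes "h @ [x] \<in> N"
  shows "query mech (enc h) = fst x"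
proof -
  obtain P where "branches N h = Pair (fst x) ` P"
    using N_snoc_query assms by (metis prod.collapse)
  moreover have "x \<in> branches N h" using assms by (simp add: branches_def)
  then have "(SOME x. x \<in> branches N h) \<in> branches N h" by (rule someI)
  ultimately show ?thesis using N_snocD[OF assms] by (auto simp: mech_def)
qed

lemma answers_mech [simp]: "h @ [x] \<in> N \<Longrightarrow> answers mech (u, enc (h @ [x])) = snd x"
  by (simp add: mech_def)

lemma reachable_mech:
  assumes "h \<in> N" "h' \<in> N"
  shows "(enc h, enc h') \<in> (edges mech)\<^sup>* \<longleftrightarrow> prefix h h'"
proof
  assume "(enc h, enc h') \<in> (edges mech)\<^sup>*"
  then have "\<exists>g\<in>N. enc h' = enc g \<and> prefix h g"
  proof (induction rule: rtrancl_induct)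
    case base
    then show ?case using assms(1) by blast
  next
    case (step y z)
    then obtain g k x where "g \<in> N" "y = enc g" "prefix h g"
      "k @ [x] \<in> N" "y = enc k" "z = enc (k @ [x])"
      by (auto simp: edges_mech)
    moreover from this have "g = k" using N_snocD[of k x] by auto
    ultimately show ?case by (auto simp: prefix_snoc)
  qed
  then show "prefix h h'" using assms(2) by auto
next
  show "prefix h h' \<Longrightarrow> (enc h, enc h') \<in> (edges mech)\<^sup>*"
    using assms(2)
  proof (induction h' rule: rev_induct)
    case (snoc x h')
    show ?case
    proof (cases "h = h' @ [x]")
      case False
      then have "(enc h, enc h') \<in> (edges mech)\<^sup>*"
        using snoc N_snocD[of h' x] by (auto simp: prefix_snoc)
      moreover have "(enc h', enc (h' @ [x])) \<in> edges mech"
        using snoc.prems(2) by (rule edge_mech)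
      ultimately show ?thesis by (rule rtrancl_into_rtrancl)
    qed simp
  qed simp
qed

lemma rooted_tree_mech: "rooted_tree (nodes mech) (edges mech) (root mech)"
proof -
  have "(u, enc []) \<notin> edges mech" for u
    using Nil_in_N by (auto elim!: edge_mechE)
  moreover have "\<exists>!u. (u, v) \<in> edges mech" if v: "v \<in> enc ` N - {enc []}" for v
  proof -
    obtain g where "g \<in> N" "v = enc g" "g \<noteq> []" using v by auto
    then obtain h x where hx: "h @ [x] \<in> N" "v = enc (h @ [x])"
      by (cases g rule: rev_cases) auto
    show ?thesis
    proof
      show "(enc h, v) \<in> edges mech" using hx edge_mech by simp
      fix u assume "(u, v) \<in> edges mech"
      then obtain k y where "k @ [y] \<in> N" "u = enc k" "v = enc (k @ [y])"
        by (auto simp: edges_mech)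
      then show "u = enc h" using hx by simp
    qed
  qed
  moreover have "edges mech \<subseteq> nodes mech \<times> nodes mech" by (auto elim!: edge_mechE)
  moreover have "(enc [], v) \<in> (edges mech)\<^sup>*" if "v \<in> enc ` N" for v
    using that reachable_mech[OF Nil_in_N] by auto
  ultimately show ?thesis
    using Nil_in_N unfolding rooted_tree_def nodes_mech root_mech by blast
qed

lemma out_edges_mech:
  "h \<in> N \<Longrightarrow> out_edges mech (enc h) = (\<lambda>x. (enc h, enc (h @ [x]))) ` branches N h"
  by (auto simp: out_edges_def branches_def edge_mech elim!: edge_mechE)

lemma leaves_mech: "leaves mech = enc ` {h \<in> N. branches N h = {}}"
  by (auto simp: leaves_def out_edges_mech)

lemma internal_nodes_mech: "internal_nodes mech = enc ` {h \<in> N. branches N h \<noteq> {}}"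
  by (auto simp: internal_nodes_def leaves_mech)

lemma internal_node_cases:
  assumes "n \<in> internal_nodes mech"
  obtains h m P where "h \<in> N" "n = enc h" "branches N h = Pair m ` P"
    "obvious_query M C (narrow D h) m P" "query mech n = m"
proof -
  obtain h where h: "h \<in> N" "n = enc h" "branches N h \<noteq> {}"
    using assms by (auto simp: internal_nodes_mech)
  then obtain m P where P: "branches N h = Pair m ` P" "obvious_query M C (narrow D h) m P"
    using N_cases by blast
  then obtain S where "(m, S) \<in> branches N h" using h(3) by blast
  then have "query mech n = m" using h(2) by (simp add: branches_def)
  then show thesis using that h P by blast
qed

lemma path_edges_Nil: "path_edges mech (enc []) = {}"
  using Nil_in_N by (auto simp: path_edges_def edges_mech reachable_mech)

lemma path_edges_snoc:
  assumes "h @ [x] \<in> N"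
  shows "path_edges mech (enc (h @ [x])) = insert (enc h, enc (h @ [x])) (path_edges mech (enc h))"
  using assms N_snocD[OF assms]
  by (auto simp: path_edges_def edge_mech reachable_mech prefix_snoc elim!: edge_mechE)

lemma path_edgesE:
  assumes "e \<in> path_edges mech (enc h)" "h \<in> N"
  obtains g x where "g @ [x] \<in> N" "e = (enc g, enc (g @ [x]))" "prefix (g @ [x]) h"
proof -
  obtain u v where e: "e = (u, v)" by (cases e)
  then have uv: "(u, v) \<in> edges mech" "(v, enc h) \<in> (edges mech)\<^sup>*"
    using assms(1) by (auto simp: path_edges_def)
  obtain g x where "g @ [x] \<in> N" "u = enc g" "v = enc (g @ [x])"
    using edge_mechE[OF uv(1)] .
  then show thesis using that e uv(2) assms(2) by (simp add: reachable_mech)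
qed

lemma passes_through_mech:
  assumes "p \<in> Pi\<^sub>E M D"
  shows "h \<in> N \<Longrightarrow> passes_through mech p (enc h) \<longleftrightarrow> p \<in> Pi\<^sub>E M (narrow D h)"
proof (induction h rule: rev_induct)
  case Nil
  then show ?case using assms by (simp add: passes_through_def path_edges_Nil)
next
  case (snoc x h)
  then show ?case
    using box_snoc[of h "fst x" "snd x"] N_snocD[of h x]
    by (auto simp: passes_through_def path_edges_snoc)
qed

lemma outcome_leaf:
  assumes "h \<in> N" "branches N h = {}" "p \<in> Pi\<^sub>E M (narrow D h)"
  shows "outcome mech (enc h) = C p"
proof -
  have "(SOME p. p \<in> Pi\<^sub>E M (narrow D h)) \<in> Pi\<^sub>E M (narrow D h)"
    using assms(3) unfolding some_in_eq by (metis empty_iff)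
  moreover have "\<forall>p\<in>Pi\<^sub>E M (narrow D h). \<forall>p'\<in>Pi\<^sub>E M (narrow D h). C p = C p'"
    using N_cases[OF assms(1)] assms(2) unfolding obvious_query_def by (metis image_is_empty)
  ultimately have "C (SOME p. p \<in> Pi\<^sub>E M (narrow D h)) = C p" using assms(3) by blast
  then show ?thesis using assms by (auto simp: mech_def)
qed

lemma implemented_rule_mech:
  assumes "p \<in> Pi\<^sub>E M D"
  shows "implemented_rule mech p = C p"
proof -
  obtain h where h: "h \<in> N" "branches N h = {}" "p \<in> Pi\<^sub>E M (narrow D h)"
    and uniq: "\<And>g. g \<in> N \<Longrightarrow> branches N g = {} \<Longrightarrow> p \<in> Pi\<^sub>E M (narrow D g) \<Longrightarrow> g = h"
    using ex1_leaf_history[OF assms] by blast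
  have "(THE n. n \<in> leaves mech \<and> passes_through mech p n) = enc h"
  proof (rule the_equality)
    show "enc h \<in> leaves mech \<and> passes_through mech p (enc h)"
      using h passes_through_mech[OF assms] by (simp add: leaves_mech)
    show "n = enc h" if n: "n \<in> leaves mech \<and> passes_through mech p n" for n
    proof -
      obtain g where g: "g \<in> N" "branches N g = {}" "n = enc g"
        using n by (auto simp: leaves_mech)
      then show ?thesis using uniq[OF g(1,2)] n passes_through_mech[OF assms g(1)] by simp
    qed
  qed
  then show ?thesis using outcome_leaf[OF h] by (simp add: implemented_rule_def)
qed

text \<open>This is \<open>last_same_query\<close> with the man as a separate parameter instead of
  the one queried at the node, who changes from node to node. Only so can one induct along the
  history.\<close>

definition "last_query h m e \<longleftrightarrow>
  e \<in> path_edges mech (enc h) \<and> query mech (fst e) = m \<and>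
  (\<forall>e'\<in>path_edges mech (enc h). query mech (fst e') = m \<longrightarrow> (snd e', snd e) \<in> (edges mech)\<^sup>*)"

text \<open>The consistency condition on answer sets: since \<open>narrow\<close> overwrites the set
  of \<open>m\<close> whenever he is queried, it holds the set on the last such edge, or the initial
  set.\<close>

lemma narrow_last_query:
  assumes "h \<in> N"
  shows "(\<forall>e. last_query h m e \<longrightarrow> answers mech e = narrow D h m) \<and>
    ((\<nexists>e. last_query h m e) \<longrightarrow> narrow D h m = D m)"
  using assms
proof (induction h rule: rev_induct)
  case Nil
  then show ?case by (simp add: last_query_def path_edges_Nil)
next
  case (snoc x h)
  obtain m' S where x: "x = (m', S)" by (cases x)
  let ?e = "(enc h, enc (h @ [x]))"
  show ?case
  proof (cases "m' = m")
    case True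
    \<comment> \<open>The new edge itself queries \<open>m\<close> and lies below all other edges of
      the path, so a last edge must coincide with it.\<close>
    have "answers mech e = S" if e: "last_query (h @ [x]) m e" for e
    proof -
      obtain g y where g: "g @ [y] \<in> N" "e = (enc g, enc (g @ [y]))" "prefix (g @ [y]) (h @ [x])"
        using path_edgesE[OF _ snoc.prems] e unfolding last_query_def by metis
      have "(snd ?e, snd e) \<in> (edges mech)\<^sup>*"
        using e snoc.prems x True by (auto simp: last_query_def path_edges_snoc)
      then have "prefix (h @ [x]) (g @ [y])"
        using g snoc.prems by (simp add: reachable_mech)
      then have "g @ [y] = h @ [x]" using g(3) prefix_order.antisym by blast
      then show ?thesis using g x by simp
    qed
    moreover have "last_query (h @ [x]) m ?e"
      using snoc.prems x True
      by (auto simp: last_query_def path_edges_snoc reachable_mech path_edges_def)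
         (metis (no_types, lifting) N_snocD edges_mech prefix_snoc reachable_mech
            rtrancl_into_rtrancl)
    ultimately show ?thesis using x True by (auto simp: narrow_snoc)
  next
    case False
    have "last_query (h @ [x]) m = last_query h m"
      using snoc.prems x False by (auto simp: fun_eq_iff last_query_def path_edges_snoc)
    then show ?thesis
      using snoc N_snocD[of h x] x False by (auto simp: narrow_snoc)
  qed
qed

lemma matching_mechanism_mech:
  assumes C: "\<And>p. p \<in> Pi\<^sub>E M D \<Longrightarrow> C p \<in> matchings M W"
    and D: "\<And>m. D m = full_prefs W"
  shows "matching_mechanism M W mech"
  unfolding matching_mechanism_def
proof (intro conjI ballI)
  show "finite (nodes mech)" using finite_N by simp
  show "rooted_tree (nodes mech) (edges mech) (root mech)" by (rule rooted_tree_mech)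
  have sub: "narrow D h m \<subseteq> full_prefs W" if "h \<in> N" for h m
    using that
  proof (induction h rule: rev_induct)
    case (snoc x h)
    obtain P where "obvious_query M C (narrow D h) (fst x) P" "snd x \<in> P"
      using N_snoc_query snoc.prems by (metis prod.collapse)
    then have "snd x \<subseteq> narrow D h (fst x)" by (auto simp: obvious_query_def)
    then have "narrow D (h @ [x]) m \<subseteq> narrow D h m"
      using narrow_snoc[of D h "fst x" "snd x"] by auto
    then show ?case using snoc.IH N_snocD[OF snoc.prems] by blast
  qed (simp add: D)
  show "outcome mech n \<in> matchings M W" if n: "n \<in> leaves mech" for n
  proof -
    obtain h where h: "h \<in> N" "branches N h = {}" "n = enc h"
      using n by (auto simp: leaves_mech)
    show ?thesis
    proof (cases "Pi\<^sub>E M (narrow D h) = {}")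
      case True
      then show ?thesis using h by (simp add: mech_def matchings_def)
    next
      case False
      then obtain p where "p \<in> Pi\<^sub>E M (narrow D h)" by blast
      then show ?thesis using outcome_leaf[OF h(1,2)] box_subset[OF h(1)] C h(3) by (metis subsetD)
    qed
  qed
  show "query mech n \<in> M" if "n \<in> internal_nodes mech" for n
    using that by (elim internal_node_cases) (auto simp: obvious_query_def)
  show "answers mech e \<noteq> {}" "answers mech e \<subseteq> full_prefs W" if e: "e \<in> edges mech" for e
  proof -
    obtain h m S where h: "h @ [(m, S)] \<in> N" "e = (enc h, enc (h @ [(m, S)]))"
      using e by (cases e) (auto simp: edges_mech)
    obtain P where "obvious_query M C (narrow D h) m P" "S \<in> P"
      using N_snoc_query[OF h(1)] .
    then have "S \<noteq> {}" by (auto simp: obvious_query_def)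
    moreover have "S \<subseteq> full_prefs W" using sub[OF h(1), of m] by (simp add: narrow_snoc)
    ultimately show "answers mech e \<noteq> {}" "answers mech e \<subseteq> full_prefs W" using h by auto
  qed
  fix n assume "n \<in> internal_nodes mech"
  then obtain h m P where h: "h \<in> N" "n = enc h" "branches N h = Pair m ` P"
    "obvious_query M C (narrow D h) m P" "query mech n = m"
    by (rule internal_node_cases)
  have mem: "h @ [(m, S)] \<in> N" if "S \<in> P" for S using h(3) that by (auto simp: branches_def)
  have out: "out_edges mech n = (\<lambda>S. (enc h, enc (h @ [(m, S)]))) ` P"
    using h by (auto simp: out_edges_mech)
  then have union: "(\<Union>e'\<in>out_edges mech n. answers mech e') = narrow D h m"
    using h(4) mem by (simp add: obvious_query_def)
  have last: "last_same_query mech n = last_query h m"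
    using h by (auto simp: fun_eq_iff last_same_query_def last_query_def)
  show "e \<noteq> e' \<longrightarrow> answers mech e \<inter> answers mech e' = {}"
    if e: "e \<in> out_edges mech n" "e' \<in> out_edges mech n" for e e'
  proof -
    obtain S S' where "S \<in> P" "e = (enc h, enc (h @ [(m, S)]))"
      "S' \<in> P" "e' = (enc h, enc (h @ [(m, S')]))"
      using e unfolding out by blast
    then show ?thesis using mem obvious_query_disjoint[OF h(4), of S S'] by auto
  qed
  show "\<forall>e. last_same_query mech n e \<longrightarrow> (\<Union>e'\<in>out_edges mech n. answers mech e') = answers mech e"
    and "(\<nexists>e. last_same_query mech n e) \<longrightarrow> (\<Union>e'\<in>out_edges mech n. answers mech e') = full_prefs W"
    unfolding union last using narrow_last_query[OF h(1), of m] D by auto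
qed

text \<open>Passing through a node means lying in its box, and diverging there means lying in two
  different parts of its partition; the claim is then the last clause of
  \<open>obvious_query\<close>.\<close>

lemma osp_mech:
  assumes D: "\<And>m. D m = full_prefs W"
  shows "osp M W mech"
  unfolding osp_def osp_for_def
proof (intro ballI impI)
  fix m n p p'
  assume n: "n \<in> internal_nodes mech" "query mech n = m"
    and p: "p \<in> profiles M W" "p' \<in> profiles M W"
    and *: "passes_through mech p n \<and> passes_through mech p' n \<and> diverge_at mech n (p m) (p' m)"
  have pD: "p \<in> Pi\<^sub>E M D" "p' \<in> Pi\<^sub>E M D"
    using p D by (auto simp: profiles_def PiE_iff)
  obtain h P where h: "h \<in> N" "n = enc h" "branches N h = Pair m ` P"
    "obvious_query M C (narrow D h) m P"
    using internal_node_cases[OF n(1)] n(2) by metis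
  have mem: "h @ [(m, S)] \<in> N" if "S \<in> P" for S using h(3) that by (auto simp: branches_def)
  obtain S S' where S: "S \<in> P" "S' \<in> P" "S \<noteq> S'" "p m \<in> S" "p' m \<in> S'"
    using * h mem by (auto simp: diverge_at_def out_edges_mech)
  have "p \<in> Pi\<^sub>E M ((narrow D h)(m := S))" "p' \<in> Pi\<^sub>E M ((narrow D h)(m := S'))"
    using * S pD h box_snoc[OF mem] by (auto simp: passes_through_mech narrow_snoc)
  then have "weakly_prefers (p m) (C p m) (C p' m)"
    using h(4) S unfolding obvious_query_def by blast
  then show "weakly_prefers (p m) (implemented_rule mech p m) (implemented_rule mech p' m)"
    using pD by (simp add: implemented_rule_mech)
qed

end

lemma osp_implementable_if_solvable:
  assumes "osp_solvable M C (\<lambda>_. full_prefs W)"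
    and C: "\<And>p. p \<in> profiles M W \<Longrightarrow> C p \<in> matchings M W"
  shows "osp_implementable M W C"
proof -
  obtain N where N: "history_tree M C (\<lambda>_. full_prefs W) N"
    using osp_solvable_history_tree[OF assms(1)] by blast
  obtain enc :: "_ \<Rightarrow> nat" where "inj_on enc N"
    using finite_imp_inj_to_nat_seg[OF history_tree.finite_N[OF N]] by blast
  with N interpret encoded_history_tree M C "\<lambda>_. full_prefs W" N enc
    by (simp add: encoded_history_tree_def encoded_history_tree_axioms_def)
  show ?thesis
    unfolding osp_implementable_def
    using matching_mechanism_mech[of W] osp_mech[of W] C
    by (intro exI[of _ mech]) (auto simp: profiles_def implemented_rule_mech)
qed

section \<open>Queries given by labels, favourites, elementary facts on matchings\<close>

lemma PiE_monoD: "p \<in> Pi\<^sub>E M D \<Longrightarrow> (\<And>m. m \<in> M \<Longrightarrow> D m \<subseteq> D' m) \<Longrightarrow> p \<in> Pi\<^sub>E M D'"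
  using PiE_mono[of M D D'] by blast

text \<open>The label \<open>f\<close> says how much of his list \<open>m\<close> reveals; the
  answers are the nonempty fibres of \<open>f\<close> on \<open>D m\<close>.\<close>

lemma osp_solvable_by_label:
  assumes m: "m \<in> M" and fin: "finite (f ` D m)"
    and solvable: "\<And>x. x \<in> f ` D m \<Longrightarrow> osp_solvable M C (D(m := {r \<in> D m. f r = x}))"
    and obvious: "\<And>p p'. p \<in> Pi\<^sub>E M D \<Longrightarrow> p' \<in> Pi\<^sub>E M D \<Longrightarrow> f (p m) \<noteq> f (p' m) \<Longrightarrow>
      weakly_prefers (p m) (C p m) (C p' m)"
  shows "osp_solvable M C D"
proof (cases "D m = {}")
  \<comment> \<open>There would be no answers at all, which \<open>obvious_query\<close> forbids;
    but the box is empty as well, and \<open>C\<close> is trivially constant on it.\<close>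
  case True
  then have "Pi\<^sub>E M D = {}" using m by (auto simp: PiE_eq_empty_iff)
  then show ?thesis by (intro osp_solvable.const) auto
next
  case False
  let ?part = "\<lambda>x. {r \<in> D m. f r = x}"
  let ?apart = "\<lambda>S S'. S \<inter> S' = {} \<and>
    (\<forall>p\<in>Pi\<^sub>E M (D(m := S)). \<forall>p'\<in>Pi\<^sub>E M (D(m := S')). weakly_prefers (p m) (C p m) (C p' m))"
  show ?thesis
  proof (rule osp_solvable.query)
    have apart: "?apart (?part x) (?part y)"
      if "x \<noteq> y" for x y
    proof (intro conjI ballI)
      fix p p' assume p: "p \<in> Pi\<^sub>E M (D(m := ?part x))" "p' \<in> Pi\<^sub>E M (D(m := ?part y))"
      then have "p m \<in> ?part x" "p' m \<in> ?part y" using PiE_mem[OF p(1) m] PiE_mem[OF p(2) m] by simp_all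
      moreover have "p \<in> Pi\<^sub>E M D" "p' \<in> Pi\<^sub>E M D"
        using p by (auto simp: PiE_iff split: if_splits)
      ultimately show "weakly_prefers (p m) (C p m) (C p' m)" using that by (intro obvious) auto
    qed (use that in auto)
    have "\<forall>S\<in>?part ` f ` D m. \<forall>S'\<in>?part ` f ` D m. S \<noteq> S' \<longrightarrow> ?apart S S'"
    proof (intro ballI impI)
      fix S S' assume SS': "S \<in> ?part ` f ` D m" "S' \<in> ?part ` f ` D m" "S \<noteq> S'"
      obtain x where x: "S = ?part x" using SS'(1) by (elim imageE)
      obtain y where y: "S' = ?part y" using SS'(2) by (elim imageE)
      have "x \<noteq> y" using SS'(3) x y by metis
      then show "?apart S S'" unfolding x y by (rule apart)
    qed
    moreover have "finite (?part ` f ` D m)" "?part ` f ` D m \<noteq> {}" using fin False by simp_all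
    moreover have "{} \<notin> ?part ` f ` D m" "\<Union>(?part ` f ` D m) = D m" by auto
    ultimately show "obvious_query M C D m (?part ` f ` D m)"
      using m by (simp only: obvious_query_def simp_thms)
    show "osp_solvable M C (D(m := S))" if "S \<in> ?part ` f ` D m" for S
      using that solvable by blast
  qed
qed

definition best :: "'a rel \<Rightarrow> 'a set \<Rightarrow> 'a" where
  "best r B = (THE x. x \<in> B \<and> (\<forall>y\<in>B - {x}. (x, y) \<in> r))"

lemma full_prefsD:
  assumes "r \<in> full_prefs A"
  shows "(x, y) \<in> r \<Longrightarrow> (y, z) \<in> r \<Longrightarrow> (x, z) \<in> r" "(x, x) \<notin> r"
    "(x, y) \<in> r \<Longrightarrow> (y, x) \<notin> r"
    "x \<in> A \<Longrightarrow> y \<in> A \<Longrightarrow> x \<noteq> y \<Longrightarrow> (x, y) \<in> r \<or> (y, x) \<in> r"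
  using assms
  by (auto simp: full_prefs_def strict_linear_order_on_def irrefl_def total_on_def dest: transD)

lemma best:
  assumes r: "r \<in> full_prefs A" and B: "finite B" "B \<subseteq> A" "B \<noteq> {}"
  shows best_in: "best r B \<in> B"
    and best_above: "\<And>y. y \<in> B \<Longrightarrow> y \<noteq> best r B \<Longrightarrow> (best r B, y) \<in> r"
proof -
  have "\<exists>x. x \<in> B \<and> (\<forall>y\<in>B - {x}. (x, y) \<in> r)"
    using B(1,3,2)
  proof (induction rule: finite_ne_induct)
    case (insert z B)
    then obtain x where x: "x \<in> B" "\<forall>y\<in>B - {x}. (x, y) \<in> r" by auto
    then have "(x, z) \<in> r \<or> (z, x) \<in> r" using insert full_prefsD(4)[OF r, of x z] by auto
    then show ?case
    proof
      assume "(x, z) \<in> r" then show ?thesis using x by blast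
    next
      assume "(z, x) \<in> r" 
      then have "\<forall>y\<in>insert z B - {z}. (z, y) \<in> r" using x full_prefsD(1)[OF r] by blast
      then show ?thesis by blast
    qed
  qed auto
  moreover have "x = y" if "x \<in> B \<and> (\<forall>y\<in>B - {x}. (x, y) \<in> r)" "y \<in> B \<and> (\<forall>z\<in>B - {y}. (y, z) \<in> r)"
    for x y using that full_prefsD(3)[OF r] by blast
  ultimately have "\<exists>!x. x \<in> B \<and> (\<forall>y\<in>B - {x}. (x, y) \<in> r)" by (rule ex_ex1I)
  from theI'[OF this] have "best r B \<in> B \<and> (\<forall>y\<in>B - {best r B}. (best r B, y) \<in> r)"
    by (simp add: best_def)
  then show "best r B \<in> B" "\<And>y. y \<in> B \<Longrightarrow> y \<noteq> best r B \<Longrightarrow> (best r B, y) \<in> r" by auto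
qed

lemma best_weakly_prefers:
  assumes r: "r \<in> full_prefs A" and "finite B" "B \<subseteq> A" "B \<noteq> {}"
    and x: "x = None \<or> (\<exists>y\<in>B. x = Some y)"
  shows "weakly_prefers r (Some (best r B)) x"
proof (cases x)
  case (Some y)
  then have "y \<in> B" using x by simp
  then have "(y, best r B) \<notin> r"
    using best_above[OF assms(1-4)] full_prefsD(2,3)[OF r] by metis
  then show ?thesis using Some by (simp add: weakly_prefers_def)
qed (simp add: weakly_prefers_def)

lemma matchingsD:
  assumes "\<mu> \<in> matchings M W"
  shows "\<mu> m = Some w \<Longrightarrow> m \<in> M" "\<mu> m = Some w \<Longrightarrow> w \<in> W"
    "\<mu> m = Some w \<Longrightarrow> \<mu> m' = Some w \<Longrightarrow> m = m'"
  using assms unfolding matchings_def by (auto simp: ran_def) (metis domI inj_onD)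

lemma matchingsI:
  assumes "\<And>m w. \<mu> m = Some w \<Longrightarrow> m \<in> M \<and> w \<in> W"
    and "\<And>m m' w. \<mu> m = Some w \<Longrightarrow> \<mu> m' = Some w \<Longrightarrow> m = m'"
  shows "\<mu> \<in> matchings M W"
proof -
  have "inj_on \<mu> (dom \<mu>)"
    using assms(2) by (intro inj_onI) (metis domD)
  moreover have "dom \<mu> \<subseteq> M" "ran \<mu> \<subseteq> W" using assms(1) by (auto simp: ran_def)
  ultimately show ?thesis by (simp add: matchings_def)
qed

lemma partner_of_woman_eq_Some:
  assumes "\<mu> \<in> matchings M W"
  shows "partner_of_woman \<mu> w = Some m \<longleftrightarrow> \<mu> m = Some w"
proof -
  have "(THE m. \<mu> m = Some w) = m'" if "\<mu> m' = Some w" for m'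
    using that matchingsD(3)[OF assms] by (intro the_equality)
  then show ?thesis by (auto simp: partner_of_woman_def ran_def)
qed

lemma partner_of_woman_cong:
  assumes "\<And>m. \<mu> m = Some w \<longleftrightarrow> \<nu> m = Some w"
  shows "partner_of_woman \<mu> w = partner_of_woman \<nu> w"
  using assms by (simp add: partner_of_woman_def ran_def)

lemma prefers_cases:
  "prefers r (Some x) y \<longleftrightarrow> (case y of None \<Rightarrow> True | Some z \<Rightarrow> (x, z) \<in> r)"
  by (cases y) auto

section \<open>Top coalitions and optimal stable matchings\<close>

locale two_sided_market =
  fixes M :: "'m set" and W :: "'w set" and q :: "'w \<Rightarrow> 'm rel"
  assumes finite_M: "finite M" and finite_W: "finite W" and q: "q \<in> profiles W M"
begin

lemma q_full: "w \<in> W \<Longrightarrow> q w \<in> full_prefs M"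
  using q by (auto simp: profiles_def)

text \<open>
  Members of a top coalition get their favourites in the \<open>M\<close>-optimal stable matching, and in every
  stable matching their favourites are matched within the coalition.
\<close>

definition top_coalition :: "'m set \<Rightarrow> 'w set \<Rightarrow> ('m \<Rightarrow> 'w rel) \<Rightarrow> 'm set \<Rightarrow> bool" where
  "top_coalition A B p S \<longleftrightarrow> S \<noteq> {} \<and> S \<subseteq> A \<and> inj_on (\<lambda>s. best (p s) B) S \<and>
     (\<forall>s\<in>S. \<forall>s'\<in>S. \<forall>m\<in>A - S. (s, m) \<in> q (best (p s') B))"

text \<open>A stable matching may permute the favourites among the members of \<open>S\<close>, but
  it cannot match them outside \<open>S\<close>. Hence its restriction to the remaining men is a
  stable matching of the remaining market, where the optimality of \<open>\<mu>\<close>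
  applies.\<close>

lemma M_optimal_stable_top_coalition:
  assumes S: "top_coalition A B p S" and A: "A \<subseteq> M" and B: "B \<subseteq> W" "B \<noteq> {}"
    and p: "\<And>m. m \<in> A \<Longrightarrow> p m \<in> full_prefs W"
    and \<mu>: "M_optimal_stable (A - S) (B - (\<lambda>s. best (p s) B) ` S) p q \<mu>"
  shows "M_optimal_stable A B p q (\<lambda>m. if m \<in> S then Some (best (p m) B) else \<mu> m)"
proof -
  define \<tau> where "\<tau> = (\<lambda>s. best (p s) B)"
  define \<mu>' where "\<mu>' = (\<lambda>m. if m \<in> S then Some (\<tau> m) else \<mu> m)"
  let ?A = "A - S" and ?B = "B - \<tau> ` S"
  have SA: "S \<subseteq> A" and inj: "inj_on \<tau> S"
    and top: "\<And>s s' m. s \<in> S \<Longrightarrow> s' \<in> S \<Longrightarrow> m \<in> A \<Longrightarrow> m \<notin> S \<Longrightarrow> (s, m) \<in> q (\<tau> s')"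
    using S by (auto simp: top_coalition_def \<tau>_def)
  have finB: "finite B" using B finite_W finite_subset by blast
  have \<tau>: "\<tau> m \<in> B" "\<And>w. w \<in> B \<Longrightarrow> w \<noteq> \<tau> m \<Longrightarrow> (\<tau> m, w) \<in> p m" if "m \<in> A" for m
    using best[OF p[OF that] finB B] by (auto simp: \<tau>_def)
  note pD = full_prefsD[OF p] and qD = full_prefsD[OF q_full]
  have \<mu>: "\<mu> \<in> matchings ?A ?B" "stable ?A ?B p q \<mu>"
    and opt: "\<And>\<nu> m. \<nu> \<in> matchings ?A ?B \<Longrightarrow> stable ?A ?B p q \<nu> \<Longrightarrow> m \<in> ?A \<Longrightarrow>
      weakly_prefers (p m) (\<mu> m) (\<nu> m)"
    using assms(6) by (auto simp: M_optimal_stable_def \<tau>_def)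
  have \<mu>': "\<mu>' \<in> matchings A B"
  proof (rule matchingsI)
    show "m \<in> A \<and> w \<in> B" if "\<mu>' m = Some w" for m w
      using that \<tau>(1) SA matchingsD(1,2)[OF \<mu>(1), of m w] by (auto simp: \<mu>'_def split: if_splits)
    show "m = m'" if "\<mu>' m = Some w" "\<mu>' m' = Some w" for m m' w
      using that inj matchingsD(2,3)[OF \<mu>(1)]
      by (auto simp: \<mu>'_def split: if_splits dest: inj_onD)
  qed
  have "stable A B p q \<mu>'"
    unfolding stable_def
  proof (intro notI, elim bexE conjE)
    fix m w assume m: "m \<in> A" and w: "w \<in> B" and mw: "prefers (p m) (Some w) (\<mu>' m)"
      and wm: "prefers (q w) (Some m) (partner_of_woman \<mu>' w)"
    have "m \<notin> S"
      using mw \<tau>(2)[OF m w] pD(2,3)[OF m] by (cases "w = \<tau> m") (auto simp: \<mu>'_def)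
    have "w \<notin> \<tau> ` S"
    proof
      assume "w \<in> \<tau> ` S"
      then obtain s where s: "s \<in> S" "w = \<tau> s" by blast
      then have "\<mu>' s = Some w" by (simp add: \<mu>'_def)
      then have "partner_of_woman \<mu>' w = Some s"
        by (simp add: partner_of_woman_eq_Some[OF \<mu>'])
      then show False
        using wm top[OF s(1,1) m \<open>m \<notin> S\<close>] qD(3)[of w] w B s(2) by auto
    qed
    then have "partner_of_woman \<mu>' w = partner_of_woman \<mu> w"
      using matchingsD(1)[OF \<mu>(1)]
      by (intro partner_of_woman_cong) (auto simp: \<mu>'_def)
    then show False
      using \<mu>(2) m w mw wm \<open>m \<notin> S\<close> \<open>w \<notin> \<tau> ` S\<close> by (auto simp: stable_def \<mu>'_def)
  qed
  moreover have "weakly_prefers (p m) (\<mu>' m) (\<nu> m)"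
    if \<nu>: "\<nu> \<in> matchings A B" "stable A B p q \<nu>" and m: "m \<in> A" for \<nu> m
  proof (cases "m \<in> S")
    case True
    then show ?thesis
      using best_weakly_prefers[OF p[OF m] finB B, of "\<nu> m"] matchingsD(2)[OF \<nu>(1), of m]
      by (cases "\<nu> m") (auto simp: \<mu>'_def \<tau>_def)
  next
    case False
    \<comment> \<open>Otherwise \<open>s\<close> and \<open>\<tau> s\<close> block
      \<open>\<nu>\<close>: he lacks his favourite, and she has an outsider or nobody.\<close>
    have "\<tau> s \<in> {w. \<exists>s'\<in>S. \<nu> s' = Some w}" if s: "s \<in> S" for s
    proof (rule ccontr)
      assume *: "\<tau> s \<notin> {w. \<exists>s'\<in>S. \<nu> s' = Some w}"
      have sA: "s \<in> A" using s SA by blast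
      have "prefers (p s) (Some (\<tau> s)) (\<nu> s)"
        using * s \<tau>(2)[OF sA] matchingsD(2)[OF \<nu>(1), of s]
        by (auto simp: prefers_cases split: option.split)
      moreover have "prefers (q (\<tau> s)) (Some s) (partner_of_woman \<nu> (\<tau> s))"
        using * top[OF s s] matchingsD(1)[OF \<nu>(1)]
        by (auto simp: prefers_cases partner_of_woman_eq_Some[OF \<nu>(1)] split: option.split)
      ultimately show False using \<nu>(2) sA \<tau>(1)[OF sA] by (auto simp: stable_def)
    qed
    \<comment> \<open>There are as many favourites as members, so by counting the inclusion is an
      equality and no member has another partner.\<close>
    then have "Some ` \<tau> ` S \<subseteq> \<nu> ` S" by force
    moreover have "finite S" using SA A finite_M finite_subset by metis
    moreover have "card (\<nu> ` S) \<le> card (Some ` \<tau> ` S)"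
      using inj \<open>finite S\<close> by (simp add: card_image card_image_le)
    ultimately have \<nu>S: "\<nu> ` S = Some ` \<tau> ` S" by (metis card_seteq finite_imageI)
    define \<nu>' where "\<nu>' = \<nu> |` (A - S)"
    have in_S: "x \<in> S \<longleftrightarrow> w \<in> \<tau> ` S" if "\<nu> x = Some w" for x w
    proof
      assume "x \<in> S"
      then have "Some w \<in> Some ` \<tau> ` S" using \<nu>S that by (metis imageI)
      then show "w \<in> \<tau> ` S" by blast
    next
      assume "w \<in> \<tau> ` S"
      then have "Some w \<in> \<nu> ` S" using \<nu>S by blast
      then show "x \<in> S" using that matchingsD(3)[OF \<nu>(1)] by (metis imageE)
    qed
    have \<nu>': "\<nu>' \<in> matchings ?A ?B"
    proof (rule matchingsI)
      show "m \<in> ?A \<and> w \<in> ?B" if "\<nu>' m = Some w" for m w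
        using that in_S[of m w] matchingsD(1,2)[OF \<nu>(1), of m w]
        by (auto simp: \<nu>'_def restrict_map_def split: if_splits)
      show "m = m'" if "\<nu>' m = Some w" "\<nu>' m' = Some w" for m m' w
        using that matchingsD(3)[OF \<nu>(1), of m w m']
        by (auto simp: \<nu>'_def restrict_map_def split: if_splits)
    qed
    have "stable ?A ?B p q \<nu>'"
      unfolding stable_def
    proof (intro notI, elim bexE conjE)
      fix x w assume x: "x \<in> ?A" and w: "w \<in> ?B" and xw: "prefers (p x) (Some w) (\<nu>' x)"
        and wx: "prefers (q w) (Some x) (partner_of_woman \<nu>' w)"
      have "partner_of_woman \<nu>' w = partner_of_woman \<nu> w"
        using w in_S matchingsD(1)[OF \<nu>(1)]
        by (intro partner_of_woman_cong) (auto simp: \<nu>'_def restrict_map_def)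
      then show False using \<nu>(2) x w xw wx by (auto simp: stable_def \<nu>'_def)
    qed
    then have "weakly_prefers (p m) (\<mu> m) (\<nu>' m)" using opt[OF \<nu>'] m False by blast
    then show ?thesis using m False by (simp add: \<mu>'_def \<nu>'_def)
  qed
  ultimately show ?thesis using \<mu>' unfolding M_optimal_stable_def \<mu>'_def \<tau>_def by blast
qed

lemma M_optimal_stable_unique:
  assumes "M_optimal_stable A B p q \<mu>" "M_optimal_stable A B p q \<nu>" "B \<subseteq> W"
    and p: "\<And>m. m \<in> A \<Longrightarrow> p m \<in> full_prefs W"
  shows "\<mu> = \<nu>"
proof
  fix m
  have mu: "\<mu> \<in> matchings A B" "\<nu> \<in> matchings A B"
    using assms by (auto simp: M_optimal_stable_def)
  show "\<mu> m = \<nu> m"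
  proof (cases "m \<in> A")
    case True
    then have "weakly_prefers (p m) (\<mu> m) (\<nu> m)" "weakly_prefers (p m) (\<nu> m) (\<mu> m)"
      using assms by (auto simp: M_optimal_stable_def)
    moreover have "a = b \<or> (a, b) \<in> p m \<or> (b, a) \<in> p m" if "\<mu> m = Some a" "\<nu> m = Some b" for a b
      using full_prefsD(4)[OF p[OF True], of a b] that
        matchingsD(2)[OF mu(1)] matchingsD(2)[OF mu(2)] assms(3) by blast
    ultimately show ?thesis
      by (cases "\<mu> m"; cases "\<nu> m") (auto simp: weakly_prefers_def)
  next
    case False
    then show ?thesis
      using matchingsD(1)[OF mu(1)] matchingsD(1)[OF mu(2)] by (metis not_Some_eq)
  qed
qed

lemma M_optimal_ruleI:
  assumes "M_optimal_stable A B p q \<mu>" "B \<subseteq> W" "\<And>m. m \<in> A \<Longrightarrow> p m \<in> full_prefs W"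
  shows "M_optimal_rule A B q p = \<mu>"
  unfolding M_optimal_rule_def
proof (rule the_equality)
  show "\<nu> = \<mu>" if "M_optimal_stable A B p q \<nu>" for \<nu>
    using that assms by (rule M_optimal_stable_unique)
qed (rule assms)

end

section \<open>Acyclical profiles: top men and existence\<close>

locale acyclical_market = two_sided_market M W q
  for M :: "'m set" and W :: "'w set" and q :: "'w \<Rightarrow> 'm rel" +
  assumes acyclical: "acyclical M W q"
begin

text \<open>If no man is first for all women of \<open>B\<close>, take a woman \<open>x\<close> with
  first man \<open>a\<close> and a woman \<open>y\<close> with another first man \<open>b\<close>.
  Acyclicality puts every third man below both, first at \<open>x\<close> and \<open>y\<close> and
  then at every other woman.\<close>

lemma at_most_two_top_men:
  assumes A: "A \<subseteq> M" "A \<noteq> {}" and B: "B \<subseteq> W"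
  obtains a where "a \<in> A" "\<And>w m. w \<in> B \<Longrightarrow> m \<in> A - {a} \<Longrightarrow> (a, m) \<in> q w"
  | a b where "a \<in> A" "b \<in> A" "a \<noteq> b"
      "\<And>w m. w \<in> B \<Longrightarrow> m \<in> A - {a, b} \<Longrightarrow> (a, m) \<in> q w \<and> (b, m) \<in> q w"
proof (cases "\<exists>a\<in>A. \<forall>w\<in>B. \<forall>m\<in>A - {a}. (a, m) \<in> q w")
  case True
  then show ?thesis using that(1) by blast
next
  case False
  have no_cycle: "(c, a) \<notin> q y"
    if "a \<in> A" "b \<in> A" "c \<in> A" "x \<in> B" "y \<in> B" "(a, b) \<in> q x" "(b, c) \<in> q x" for a b c x y
    using acyclical that A B unfolding cyclical_def by blast
  have qD: "q w \<in> full_prefs M" if "w \<in> B" for w using q_full that B by blast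
  have fin: "finite A" using A finite_M finite_subset by blast
  obtain x where x: "x \<in> B" using False A by blast
  define a where "a = best (q x) A"
  have a: "a \<in> A" "\<And>m. m \<in> A \<Longrightarrow> m \<noteq> a \<Longrightarrow> (a, m) \<in> q x"
    using best[OF qD[OF x] fin A] by (auto simp: a_def)
  then obtain y m0 where y: "y \<in> B" "m0 \<in> A" "m0 \<noteq> a" "(a, m0) \<notin> q y" using False by blast
  define b where "b = best (q y) A"
  have b: "b \<in> A" "\<And>m. m \<in> A \<Longrightarrow> m \<noteq> b \<Longrightarrow> (b, m) \<in> q y"
    using best[OF qD[OF y(1)] fin A] by (auto simp: b_def)
  have "a \<noteq> b" using b(2) y by blast
  have total: "(c, d) \<in> q w \<or> (d, c) \<in> q w" if "c \<in> A" "d \<in> A" "c \<noteq> d" "w \<in> B" for c d w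
    using full_prefsD(4)[OF qD[OF that(4)]] that A by blast
  have "(a, m) \<in> q w \<and> (b, m) \<in> q w" if w: "w \<in> B" and m: "m \<in> A - {a, b}" for w m
  proof -
    \<comment> \<open>Otherwise \<open>x\<close> ranks \<open>a\<close>, \<open>m\<close>,
      \<open>b\<close> in this order, while \<open>y\<close> ranks \<open>b\<close> above
      \<open>a\<close>. The next step is the mirror image.\<close>
    have bx: "(b, m) \<in> q x"
      using total[of b m x] no_cycle[of a m b x y] a b m x y(1) \<open>a \<noteq> b\<close> by blast
    have ay: "(a, m) \<in> q y"
      using total[of a m y] no_cycle[of b m a y x] a b m x y(1) \<open>a \<noteq> b\<close> by blast
    \<comment> \<open>Now \<open>x\<close> ranks \<open>a\<close>, \<open>b\<close>,
      \<open>m\<close> in this order, so \<open>w\<close> cannot put \<open>m\<close> above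
      \<open>a\<close>; and \<open>y\<close> ranks \<open>b\<close>, \<open>a\<close>,
      \<open>m\<close>, so \<open>w\<close> cannot put \<open>m\<close> above
      \<open>b\<close>.\<close>
    show ?thesis
      using total[of a m w] total[of b m w] no_cycle[of a b m x w] no_cycle[of b a m y w]
        a b m w x y(1) bx ay \<open>a \<noteq> b\<close> by blast
  qed
  then show ?thesis using that(2) a(1) b(1) \<open>a \<noteq> b\<close> by blast
qed


lemma top_coalition_singleton:
  assumes "a \<in> A" "\<And>m. m \<in> A - {a} \<Longrightarrow> (a, m) \<in> q (best (p a) B)"
  shows "top_coalition A B p {a}"
  using assms by (auto simp: top_coalition_def)

lemma top_coalition_pair:
  assumes "a \<in> A" "b \<in> A" "best (p a) B \<noteq> best (p b) B"
    "\<And>m s. m \<in> A - {a, b} \<Longrightarrow> s \<in> {a, b} \<Longrightarrow>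
      (a, m) \<in> q (best (p s) B) \<and> (b, m) \<in> q (best (p s) B)"
  shows "top_coalition A B p {a, b}"
  using assms by (auto simp: top_coalition_def)

text \<open>With two top men, one of them stands alone if his own favourite prefers him to the
  other. Failing that, the favourite of \<open>a\<close> prefers \<open>b\<close> and vice versa, so
  these women are distinct and the men form a coalition together.\<close>

lemma top_coalition_exists:
  assumes A: "A \<subseteq> M" "A \<noteq> {}" and B: "B \<subseteq> W" "B \<noteq> {}"
    and p: "\<And>m. m \<in> A \<Longrightarrow> p m \<in> full_prefs W"
  shows "\<exists>S. top_coalition A B p S"
proof -
  have best_B: "best (p m) B \<in> B" if "m \<in> A" for m
    using best_in[OF p[OF that] _ B] B finite_W finite_subset by blast
  from at_most_two_top_men[OF A B(1)] show ?thesis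
  proof cases
    case (1 a)
    then have "top_coalition A B p {a}" using best_B by (intro top_coalition_singleton) auto
    then show ?thesis ..
  next
    case (2 a b)
    have total: "(a, b) \<in> q w \<or> (b, a) \<in> q w" if "w \<in> B" for w
      using full_prefsD(4)[OF q_full, of w a b] that 2 A B by blast
    consider "(a, b) \<in> q (best (p a) B)" | "(b, a) \<in> q (best (p b) B)"
      | "(b, a) \<in> q (best (p a) B)" "(a, b) \<in> q (best (p b) B)"
      using total best_B 2 by blast
    then show ?thesis
    proof cases
      case 1
      then have "top_coalition A B p {a}"
        using best_B 2 by (intro top_coalition_singleton) auto
      then show ?thesis ..
    next
      case 2
      then have "top_coalition A B p {b}"
        using best_B \<open>a \<in> A\<close> \<open>b \<in> A\<close> \<open>\<And>w m. w \<in> B \<Longrightarrow> m \<in> A - {a, b} \<Longrightarrow> (a, m) \<in> q w \<and> (b, m) \<in> q w\<close>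
        by (intro top_coalition_singleton) auto
      then show ?thesis ..
    next
      case 3
      have "best (p a) B \<in> W" using best_B[OF \<open>a \<in> A\<close>] B by blast
      then have "best (p a) B \<noteq> best (p b) B"
        using 3 full_prefsD(3)[OF q_full, of _ a b] by metis
      then have "top_coalition A B p {a, b}"
        using best_B 2 by (intro top_coalition_pair) auto
      then show ?thesis ..
    qed
  qed
qed

text \<open>\<open>card A \<le> card B\<close> is the invariant that keeps a woman available as long
  as a man is left; a coalition and its favourites are equally many.\<close>

lemma card_top_coalition:
  assumes "top_coalition A B p S" "A \<subseteq> M" "B \<subseteq> W" "card A \<le> card B"
    and p: "\<And>m. m \<in> A \<Longrightarrow> p m \<in> full_prefs W"
  shows "B \<noteq> {}" "card (A - S) \<le> card (B - (\<lambda>s. best (p s) B) ` S)" "card (A - S) < card A"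
proof -
  have fin: "finite A" "finite B" using assms finite_M finite_W finite_subset by blast+
  have S: "S \<subseteq> A" "S \<noteq> {}" "inj_on (\<lambda>s. best (p s) B) S"
    using assms by (auto simp: top_coalition_def)
  have "finite S" using S fin finite_subset by blast
  show "card (A - S) < card A" using S fin by (intro psubset_card_mono) auto
  have "card A \<noteq> 0" using S fin by auto
  then show "B \<noteq> {}" using assms(4) by auto
  then have "(\<lambda>s. best (p s) B) ` S \<subseteq> B" using best_in[OF p fin(2) assms(3)] S(1) by blast
  moreover have "card ((\<lambda>s. best (p s) B) ` S) = card S" by (rule card_image[OF S(3)])
  ultimately show "card (A - S) \<le> card (B - (\<lambda>s. best (p s) B) ` S)"
    using S fin assms(4) \<open>finite S\<close> by (simp add: card_Diff_subset)
qed

text \<open>Removing top coalitions one after the other takes the place of deferred acceptance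
  here.\<close>

lemma M_optimal_stable_exists:
  assumes "A \<subseteq> M" "B \<subseteq> W" "card A \<le> card B" "\<And>m. m \<in> A \<Longrightarrow> p m \<in> full_prefs W"
  shows "\<exists>\<mu>. M_optimal_stable A B p q \<mu>"
  using assms
proof (induction "card A" arbitrary: A B rule: less_induct)
  case less
  show ?case
  proof (cases "A = {}")
    case True
    then have "M_optimal_stable A B p q Map.empty"
      by (auto simp: M_optimal_stable_def matchings_def stable_def)
    then show ?thesis by blast
  next
    case False
    then have "card A \<noteq> 0" using less.prems(1) finite_M finite_subset by fastforce
    then have "B \<noteq> {}" using less.prems(3) by auto
    with less.prems(1) False less.prems(2) have "\<exists>S. top_coalition A B p S"
      using less.prems(4) by (rule top_coalition_exists)
    then obtain S where S: "top_coalition A B p S" by blast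
    note card = card_top_coalition[OF S less.prems]
    have "\<exists>\<mu>. M_optimal_stable (A - S) (B - (\<lambda>s. best (p s) B) ` S) p q \<mu>"
      using less.prems by (intro less.hyps card) auto
    then show ?thesis
      using M_optimal_stable_top_coalition[OF S less.prems(1,2) card(1) less.prems(4)] by blast
  qed
qed

lemma M_optimal_stable_rule:
  assumes "A \<subseteq> M" "B \<subseteq> W" "card A \<le> card B" "\<And>m. m \<in> A \<Longrightarrow> p m \<in> full_prefs W"
  shows "M_optimal_stable A B p q (M_optimal_rule A B q p)"
proof -
  have "\<exists>\<mu>. M_optimal_stable A B p q \<mu>" using assms by (rule M_optimal_stable_exists)
  then obtain \<mu> where "M_optimal_stable A B p q \<mu>" by blast
  moreover from this have "M_optimal_rule A B q p = \<mu>" using assms(2,4) by (rule M_optimal_ruleI)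
  ultimately show ?thesis by simp
qed

lemma M_optimal_rule_matching:
  assumes "A \<subseteq> M" "B \<subseteq> W" "card A \<le> card B" "\<And>m. m \<in> A \<Longrightarrow> p m \<in> full_prefs W"
  shows "M_optimal_rule A B q p \<in> matchings A B"
  using M_optimal_stable_rule[OF assms] by (simp add: M_optimal_stable_def)

lemma M_optimal_rule_top_coalition:
  assumes S: "top_coalition A B p S"
    and AB: "A \<subseteq> M" "B \<subseteq> W" "card A \<le> card B" "\<And>m. m \<in> A \<Longrightarrow> p m \<in> full_prefs W"
  shows "M_optimal_rule A B q p = (\<lambda>m. if m \<in> S then Some (best (p m) B)
    else M_optimal_rule (A - S) (B - (\<lambda>s. best (p s) B) ` S) q p m)"
proof (rule M_optimal_ruleI[OF M_optimal_stable_top_coalition[OF S AB(1,2) _ AB(4)] AB(2,4)])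
  note card = card_top_coalition[OF S AB]
  show "B \<noteq> {}" by (rule card)
  show "M_optimal_stable (A - S) (B - (\<lambda>s. best (p s) B) ` S) p q
     (M_optimal_rule (A - S) (B - (\<lambda>s. best (p s) B) ` S) q p)"
    using AB by (intro M_optimal_stable_rule card) auto
qed

section \<open>The query strategy and its obviousness\<close>

text \<open>
  On the box of \<open>D\<close>, the rule \<open>C\<close> has settled on \<open>\<sigma>\<close>, and the men \<open>A\<close> and women \<open>B\<close> are left.
\<close>

definition reduced_to ::
  "('m, 'w) rule \<Rightarrow> ('m \<Rightarrow> 'w rel set) \<Rightarrow> 'm set \<Rightarrow> 'w set \<Rightarrow> ('m, 'w) matching \<Rightarrow> bool" where
  "reduced_to C D A B \<sigma> \<longleftrightarrow>
     A \<subseteq> M \<and> B \<subseteq> W \<and> card A \<le> card B \<and> (\<forall>m\<in>M. D m \<subseteq> full_prefs W) \<and> A \<inter> dom \<sigma> = {} \<and>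
     (\<forall>p\<in>Pi\<^sub>E M D. C p = \<sigma> ++ M_optimal_rule A B q p)"

lemma reduced_toD:
  assumes "reduced_to C D A B \<sigma>" "p \<in> Pi\<^sub>E M D"
  shows "\<And>m. m \<in> M \<Longrightarrow> p m \<in> full_prefs W"
    and "C p = \<sigma> ++ M_optimal_rule A B q p"
    and "M_optimal_rule A B q p \<in> matchings A B"
    and "\<And>m. m \<in> A \<Longrightarrow> C p m = M_optimal_rule A B q p m"
proof -
  show p: "\<And>m. m \<in> M \<Longrightarrow> p m \<in> full_prefs W"
    and C: "C p = \<sigma> ++ M_optimal_rule A B q p"
    using assms PiE_mem[OF assms(2)] unfolding reduced_to_def by blast+
  show "M_optimal_rule A B q p \<in> matchings A B"
    using assms(1) p by (intro M_optimal_rule_matching) (auto simp: reduced_to_def)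
  show "C p m = M_optimal_rule A B q p m" if "m \<in> A" for m
  proof -
    have "\<sigma> m = None" using that assms(1) by (auto simp: reduced_to_def)
    then show ?thesis using C by (simp add: map_add_def split: option.split)
  qed
qed

lemma reduced_to_mono:
  assumes red: "reduced_to C D A B \<sigma>" and D': "\<And>m. m \<in> M \<Longrightarrow> D' m \<subseteq> D m"
  shows "reduced_to C D' A B \<sigma>"
proof -
  have "\<forall>p\<in>Pi\<^sub>E M D'. C p = \<sigma> ++ M_optimal_rule A B q p"
    using reduced_toD(2)[OF red] PiE_mono[of M D' D, OF D'] by (metis subsetD)
  moreover have "\<forall>m\<in>M. D m \<subseteq> full_prefs W" using red by (simp add: reduced_to_def)
  then have "\<forall>m\<in>M. D' m \<subseteq> full_prefs W" using D' by blast
  ultimately show ?thesis using red by (simp add: reduced_to_def)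
qed

text \<open>The coalition and its favourites must be the same on the whole box, so that a single
  \<open>\<sigma>\<close> records them. A profile from the nonempty box yields the facts about
  \<open>S\<close> and the cardinalities.\<close>

lemma reduced_to_top_coalition:
  assumes red: "reduced_to C D A B \<sigma>" and D': "\<And>m. m \<in> M \<Longrightarrow> D' m \<subseteq> D m"
    and S: "\<And>p. p \<in> Pi\<^sub>E M D' \<Longrightarrow> top_coalition A B p S"
    and \<tau>: "\<And>p s. p \<in> Pi\<^sub>E M D' \<Longrightarrow> s \<in> S \<Longrightarrow> best (p s) B = \<tau> s"
    and ne: "Pi\<^sub>E M D' \<noteq> {}"
  shows "reduced_to C D' (A - S) (B - \<tau> ` S) (\<lambda>m. if m \<in> S then Some (\<tau> m) else \<sigma> m)"
    and "card (A - S) < card A"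
proof -
  have sub: "Pi\<^sub>E M D' \<subseteq> Pi\<^sub>E M D" using D' by (rule PiE_mono)
  have AB: "A \<subseteq> M" "B \<subseteq> W" "card A \<le> card B" using red by (auto simp: reduced_to_def)
  have p: "p m \<in> full_prefs W" if "p \<in> Pi\<^sub>E M D'" "m \<in> A" for p m
    using reduced_toD(1)[OF red] sub that AB by blast
  have im: "(\<lambda>s. best (p s) B) ` S = \<tau> ` S" if "p \<in> Pi\<^sub>E M D'" for p
    using \<tau>[OF that] by auto
  obtain p0 where p0: "p0 \<in> Pi\<^sub>E M D'" using ne by blast
  note card = card_top_coalition[OF S[OF p0] AB p[OF p0]]
  show "card (A - S) < card A" by (rule card)
  have SA: "S \<subseteq> A" using S[OF p0] by (simp add: top_coalition_def)
  have "C p = (\<lambda>m. if m \<in> S then Some (\<tau> m) else \<sigma> m) ++ M_optimal_rule (A - S) (B - \<tau> ` S) q p"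
    if pD': "p \<in> Pi\<^sub>E M D'" for p
  proof -
    let ?\<mu> = "M_optimal_rule (A - S) (B - \<tau> ` S) q p"
    have "?\<mu> \<in> matchings (A - S) (B - \<tau> ` S)"
      using AB p[OF pD'] card(2) im[OF p0] by (intro M_optimal_rule_matching) auto
    then have "?\<mu> m = None" if "m \<in> S" for m using matchingsD(1) that by (metis DiffD2 not_Some_eq)
    moreover have "M_optimal_rule A B q p = (\<lambda>m. if m \<in> S then Some (\<tau> m) else ?\<mu> m)"
      using M_optimal_rule_top_coalition[OF S[OF pD'] AB p[OF pD']] \<tau>[OF pD'] im[OF pD'] by auto
    moreover have "C p = \<sigma> ++ M_optimal_rule A B q p"
      using reduced_toD(2)[OF red] sub pD' by blast
    ultimately show ?thesis by (auto simp: map_add_def split: option.split)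
  qed
  then have "\<forall>p\<in>Pi\<^sub>E M D'. C p =
    (\<lambda>m. if m \<in> S then Some (\<tau> m) else \<sigma> m) ++ M_optimal_rule (A - S) (B - \<tau> ` S) q p"
    by (rule ballI)
  moreover have "\<forall>m\<in>M. D' m \<subseteq> full_prefs W"
    using reduced_to_mono[OF red D'] by (simp add: reduced_to_def)
  moreover have "(A - S) \<inter> dom (\<lambda>m. if m \<in> S then Some (\<tau> m) else \<sigma> m) = {}"
    using red by (auto simp: reduced_to_def split: if_splits)
  moreover have "A - S \<subseteq> M" "B - \<tau> ` S \<subseteq> W" using AB by auto
  ultimately show "reduced_to C D' (A - S) (B - \<tau> ` S) (\<lambda>m. if m \<in> S then Some (\<tau> m) else \<sigma> m)"
    using card(2) unfolding im[OF p0] reduced_to_def by (intro conjI)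
qed

lemma reduced_to_top_coalition_member:
  assumes red: "reduced_to C D A B \<sigma>" and p: "p \<in> Pi\<^sub>E M D"
    and S: "top_coalition A B p S" "m \<in> S"
  shows "C p m = Some (best (p m) B)"
proof -
  have AB: "A \<subseteq> M" "B \<subseteq> W" "card A \<le> card B" using red by (auto simp: reduced_to_def)
  have p_full: "p m \<in> full_prefs W" if "m \<in> A" for m
    using reduced_toD(1)[OF red p] that AB by blast
  have "m \<in> A" using S by (auto simp: top_coalition_def)
  then have "C p m = M_optimal_rule A B q p m" by (rule reduced_toD(4)[OF red p])
  also have "\<dots> = Some (best (p m) B)"
    using M_optimal_rule_top_coalition[OF S(1) AB p_full] S(2) by simp
  finally show ?thesis .
qed

text \<open>Under \<open>p\<close> he gets his favourite in \<open>B\<close>; under every profile of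
  the box he gets some woman of \<open>B\<close> or nobody.\<close>

lemma reduced_to_top_coalition_obvious:
  assumes red: "reduced_to C D A B \<sigma>" and p: "p \<in> Pi\<^sub>E M D" "p' \<in> Pi\<^sub>E M D"
    and S: "top_coalition A B p S" "m \<in> S"
  shows "weakly_prefers (p m) (C p m) (C p' m)"
proof -
  have AB: "A \<subseteq> M" "B \<subseteq> W" "card A \<le> card B" using red by (auto simp: reduced_to_def)
  have m: "m \<in> A" using S by (auto simp: top_coalition_def)
  have pm: "p m \<in> full_prefs W" if "m \<in> A" for m
    using reduced_toD(1)[OF red p(1)] that AB by blast
  have "C p' m = None \<or> (\<exists>y\<in>B. C p' m = Some y)"
    using reduced_toD(4)[OF red p(2) m] matchingsD(2)[OF reduced_toD(3)[OF red p(2)]]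
    by (metis not_Some_eq)
  moreover have "finite B" using AB finite_W finite_subset by blast
  ultimately show ?thesis
    unfolding reduced_to_top_coalition_member[OF red p(1) S]
    using AB pm[OF m] card_top_coalition(1)[OF S(1) AB pm] by (intro best_weakly_prefers)
qed

text \<open>Induction on the number of men left. At most three queries make a top coalition and its
  favourites constant on the box, and then \<open>next_round\<close> passes to fewer men.\<close>

lemma osp_solvable_if_reduced_to:
  "reduced_to C D A B \<sigma> \<Longrightarrow> osp_solvable M C D"
proof (induction "card A" arbitrary: A B D \<sigma> rule: less_induct)
  case less
  note red = less.prems
  have AB: "A \<subseteq> M" "B \<subseteq> W" "card A \<le> card B" and D: "\<And>m. m \<in> M \<Longrightarrow> D m \<subseteq> full_prefs W"
    using red by (auto simp: reduced_to_def)
  have finB: "finite B" using AB finite_W finite_subset by blast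
  have restricted: "p \<in> Pi\<^sub>E M D' \<Longrightarrow> m \<in> M \<Longrightarrow> p m \<in> D' m" for p D' and m :: 'm
    by (rule PiE_mem)
  have next_round: "osp_solvable M C D'"
    if "\<And>m. m \<in> M \<Longrightarrow> D' m \<subseteq> D m"
      "\<And>p. p \<in> Pi\<^sub>E M D' \<Longrightarrow> top_coalition A B p S"
      "\<And>p s. p \<in> Pi\<^sub>E M D' \<Longrightarrow> s \<in> S \<Longrightarrow> best (p s) B = \<tau> s" for D' S \<tau>
  proof (cases "Pi\<^sub>E M D' = {}")
    case True
    then show ?thesis by (intro osp_solvable.const) auto
  next
    case False
    have "reduced_to C D' (A - S) (B - \<tau> ` S) (\<lambda>m. if m \<in> S then Some (\<tau> m) else \<sigma> m)"
      using red that False by (rule reduced_to_top_coalition(1))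
    moreover have "card (A - S) < card A"
      using red that False by (rule reduced_to_top_coalition(2))
    ultimately show ?thesis using less.hyps by blast
  qed
  show ?case
  proof (cases "A = {}")
    case True
    have "C p = \<sigma>" if "p \<in> Pi\<^sub>E M D" for p
    proof -
      have "M_optimal_rule A B q p m = None" for m
        using matchingsD(1)[OF reduced_toD(3)[OF red that], of m] True
        by (cases "M_optimal_rule A B q p m") auto
      then show ?thesis using reduced_toD(2)[OF red that] by (simp add: map_add_def fun_eq_iff)
    qed
    then show ?thesis by (intro osp_solvable.const) simp
  next
    case False
    then have "card A \<noteq> 0" using AB(1) finite_M finite_subset by fastforce
    then have "B \<noteq> {}" using AB(3) by auto
    then have best_B: "best r B \<in> B" if "r \<in> D m" "m \<in> A" for r m
      using best_in[OF _ finB AB(2)] D AB(1) that by blast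
    have best_pB: "best (p m) B \<in> B" if "p \<in> Pi\<^sub>E M D" "m \<in> A" for p m
      using best_B restricted that AB(1) by blast
    have finite_best: "finite ((\<lambda>r. best r B) ` D m)" if "m \<in> A" for m
      using best_B that finB by (intro finite_subset[OF _ finB]) auto
    from at_most_two_top_men[OF AB(1) False AB(2)] show ?thesis
    proof cases
      case (1 a)
      have aM: "a \<in> M" using 1 AB by blast
      have top: "top_coalition A B p {a}" if "p \<in> Pi\<^sub>E M D" for p
        using 1 best_pB[OF that] by (intro top_coalition_singleton) auto
      show ?thesis
      proof (rule osp_solvable_by_label[where f = "\<lambda>r. best r B", OF aM finite_best])
        show "a \<in> A" by (rule 1)
        show "weakly_prefers (p a) (C p a) (C p' a)" if "p \<in> Pi\<^sub>E M D" "p' \<in> Pi\<^sub>E M D" for p p'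
          using reduced_to_top_coalition_obvious[OF red that top] that by simp
        show "osp_solvable M C (D(a := {r \<in> D a. best r B = x}))" (is "osp_solvable M C ?D") for x
        proof (rule next_round)
          show sub: "?D m \<subseteq> D m" for m by auto
          show "top_coalition A B p {a}" if "p \<in> Pi\<^sub>E M ?D" for p
          proof -
            have "p \<in> Pi\<^sub>E M D" using that sub by (rule PiE_monoD)
            then show ?thesis by (rule top)
          qed
          show "best (p s) B = x" if "p \<in> Pi\<^sub>E M ?D" "s \<in> {a}" for p s
            using restricted[OF that(1) aM] that(2) by simp
        qed
      qed
    next
      case (2 a b)
      have M: "a \<in> M" "b \<in> M" using 2 AB by blast+
      \<comment> \<open>The women of \<open>Wa\<close> are those who rank \<open>a\<close> first
        among \<open>A\<close>; all others in \<open>B\<close> rank \<open>b\<close> first.\<close>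
      define Wa where "Wa = {w \<in> B. (a, b) \<in> q w}"
      have Wb: "(b, a) \<in> q w" if "w \<in> B" "w \<notin> Wa" for w
        using full_prefsD(4)[OF q_full, of w a b] that M AB 2 by (auto simp: Wa_def)
      have top_a: "top_coalition A B p {a}" if "p \<in> Pi\<^sub>E M D" "best (p a) B \<in> Wa" for p
        using 2 that by (intro top_coalition_singleton) (auto simp: Wa_def)
      have top_b: "top_coalition A B p {b}" if "p \<in> Pi\<^sub>E M D" "best (p b) B \<notin> Wa" for p
      proof (rule top_coalition_singleton[OF \<open>b \<in> A\<close>])
        fix m assume m: "m \<in> A - {b}"
        have pb: "best (p b) B \<in> B" using best_pB[OF that(1) \<open>b \<in> A\<close>] .
        show "(b, m) \<in> q (best (p b) B)"
          using Wb[OF pb that(2)] 2(4)[OF pb, of m] m by (cases "m = a") auto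
      qed
      have top_ab: "top_coalition A B p {a, b}"
        if "p \<in> Pi\<^sub>E M D" "best (p a) B \<notin> Wa" "best (p b) B \<in> Wa" for p
        using 2 that best_pB[OF that(1)] by (intro top_coalition_pair) auto
      \<comment> \<open>A single query: one answer for each woman \<open>a\<close> can claim, and
        the pooled answer \<open>None\<close> for all other lists.\<close>
      define ask_a where "ask_a = (\<lambda>r. if best r B \<in> Wa then Some (best r B) else None)"
      define D1 where "D1 = D(a := {r \<in> D a. ask_a r = None})"
      have D1_sub: "D1 m \<subseteq> D m" for m by (auto simp: D1_def)
      have red1: "reduced_to C D1 A B \<sigma>"
        using red D1_sub by (rule reduced_to_mono)
      have D1: "p \<in> Pi\<^sub>E M D" "best (p a) B \<notin> Wa" if "p \<in> Pi\<^sub>E M D1" for p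
      proof -
        show "p \<in> Pi\<^sub>E M D" using that D1_sub by (rule PiE_monoD)
        show "best (p a) B \<notin> Wa"
          using restricted[OF that M(1)] by (auto simp: D1_def ask_a_def split: if_splits)
      qed
      \<comment> \<open>Whatever \<open>b\<close> names, he is in a top coalition: alone if she is
        outside \<open>Wa\<close>, and otherwise together with \<open>a\<close>, who has just
        declined all of \<open>Wa\<close>.\<close>
      have top1: "\<exists>S. top_coalition A B p S \<and> b \<in> S" if "p \<in> Pi\<^sub>E M D1" for p
        using top_b[of p] top_ab[of p] D1[OF that] by blast
      have no_a: "osp_solvable M C D1"
      proof (rule osp_solvable_by_label[where f = "\<lambda>r. best r B", OF M(2)])
        show "finite ((\<lambda>r. best r B) ` D1 b)"
          using finite_best[OF \<open>b \<in> A\<close>] D1_sub[of b] by (meson finite_subset image_mono)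
        show "weakly_prefers (p b) (C p b) (C p' b)" if "p \<in> Pi\<^sub>E M D1" "p' \<in> Pi\<^sub>E M D1" for p p'
          using top1[OF that(1)] reduced_to_top_coalition_obvious[OF red1 that] by blast
        fix y
        define D2 where "D2 = D1(b := {r \<in> D1 b. best r B = y})"
        have D2_sub: "D2 m \<subseteq> D1 m" for m by (auto simp: D2_def)
        have red2: "reduced_to C D2 A B \<sigma>"
          using red1 D2_sub by (rule reduced_to_mono)
        have D2: "p \<in> Pi\<^sub>E M D" "best (p a) B \<notin> Wa" "best (p b) B = y" if "p \<in> Pi\<^sub>E M D2" for p
        proof -
          have "p \<in> Pi\<^sub>E M D1" using that D2_sub by (rule PiE_monoD)
          then show "p \<in> Pi\<^sub>E M D" "best (p a) B \<notin> Wa" by (fact D1)+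
          show "best (p b) B = y" using restricted[OF that M(2)] by (simp add: D2_def)
        qed
        have "osp_solvable M C D2"
        proof (cases "y \<in> Wa")
          case False
          show ?thesis
          proof (rule next_round)
            show "D2 m \<subseteq> D m" for m using D1_sub D2_sub by blast
            show "top_coalition A B p {b}" if "p \<in> Pi\<^sub>E M D2" for p
              using top_b D2[OF that] False by blast
            show "best (p s) B = y" if "p \<in> Pi\<^sub>E M D2" "s \<in> {b}" for p s
              using D2(3)[OF that(1)] that(2) by simp
          qed
        next
          case True
          \<comment> \<open>\<open>a\<close> wants a woman outside \<open>Wa\<close> and
            \<open>b\<close> one inside, so asking \<open>a\<close> for his favourite has become
            safe.\<close>
          have top2: "top_coalition A B p {a, b}" if "p \<in> Pi\<^sub>E M D2" for p
            using top_ab D2[OF that] True by blast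
          show ?thesis
          proof (rule osp_solvable_by_label[where f = "\<lambda>r. best r B", OF M(1)])
            show "finite ((\<lambda>r. best r B) ` D2 a)"
              using finite_best[OF \<open>a \<in> A\<close>] D1_sub[of a] D2_sub[of a]
              by (meson finite_subset image_mono)
            show "weakly_prefers (p a) (C p a) (C p' a)"
              if "p \<in> Pi\<^sub>E M D2" "p' \<in> Pi\<^sub>E M D2" for p p'
              using reduced_to_top_coalition_obvious[OF red2 that top2] that by blast
            fix x
            let ?D = "D2(a := {r \<in> D2 a. best r B = x})"
            show "osp_solvable M C ?D"
            proof (rule next_round)
              have sub: "?D m \<subseteq> D2 m" for m by auto
              then show "?D m \<subseteq> D m" for m using D1_sub D2_sub by blast
              have in_D2: "p \<in> Pi\<^sub>E M D2" if "p \<in> Pi\<^sub>E M ?D" for p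
                using that sub by (rule PiE_monoD)
              then show "top_coalition A B p {a, b}" if "p \<in> Pi\<^sub>E M ?D" for p
                using top2 that by blast
              show "best (p s) B = (if s = a then x else y)"
                if "p \<in> Pi\<^sub>E M ?D" "s \<in> {a, b}" for p s
                using restricted[OF that(1) M(1)] D2(3)[OF in_D2[OF that(1)]] that(2) by auto
            qed
          qed
        qed
        then show "osp_solvable M C (D1(b := {r \<in> D1 b. best r B = y}))" by (simp add: D2_def)
      qed
      show ?thesis
      proof (rule osp_solvable_by_label[where f = ask_a, OF M(1)])
        have "ask_a ` D a \<subseteq> insert None (Some ` B)" by (auto simp: ask_a_def Wa_def)
        then show "finite (ask_a ` D a)" using finB finite_subset by blast
        show "osp_solvable M C (D(a := {r \<in> D a. ask_a r = x}))" for x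
        proof (cases x)
          case None
          then show ?thesis using no_a by (simp add: D1_def)
        next
          case (Some w)
          let ?D = "D(a := {r \<in> D a. ask_a r = x})"
          have pa: "best (p a) B = w" "w \<in> Wa" if "p \<in> Pi\<^sub>E M ?D" for p
            using restricted[OF that M(1)] Some by (auto simp: ask_a_def split: if_splits)
          show ?thesis
          proof (rule next_round)
            show sub: "?D m \<subseteq> D m" for m by auto
            show "top_coalition A B p {a}" if "p \<in> Pi\<^sub>E M ?D" for p
            proof -
              have "p \<in> Pi\<^sub>E M D" using that sub by (rule PiE_monoD)
              then show ?thesis using pa[OF that] by (intro top_a) simp_all
            qed
            show "best (p s) B = w" if "p \<in> Pi\<^sub>E M ?D" "s \<in> {a}" for p s
              using pa[OF that(1)] that(2) by simp
          qed
        qed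
        fix p p' assume p: "p \<in> Pi\<^sub>E M D" "p' \<in> Pi\<^sub>E M D" and ne: "ask_a (p a) \<noteq> ask_a (p' a)"
        show "weakly_prefers (p a) (C p a) (C p' a)"
        proof (cases "best (p a) B \<notin> Wa \<and> best (p b) B \<notin> Wa")
          \<comment> \<open>Here \<open>a\<close> belongs to a top coalition under his true list,
            and the general comparison applies.\<close>
          case False
          then have "\<exists>S. top_coalition A B p S \<and> a \<in> S"
            using top_a[OF p(1)] top_ab[OF p(1)] by blast
          then show ?thesis using reduced_to_top_coalition_obvious[OF red p] by blast
        next
          case True
          \<comment> \<open>Under \<open>p\<close> the man \<open>a\<close> gives the pooled answer
            and \<open>b\<close> leaves with \<open>?y\<close>. As the labels differ,
            \<open>p'\<close> is a claim and yields \<open>?x\<close>. It remains to see that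
            \<open>?x\<close> is still among the choices of \<open>a\<close> under
            \<open>p\<close>.\<close>
          let ?x = "best (p' a) B" and ?y = "best (p b) B"
          have x: "?x \<in> Wa" using ne True by (auto simp: ask_a_def split: if_splits)
          have Cp': "C p' a = Some ?x"
            using reduced_to_top_coalition_member[OF red p(2) top_a[OF p(2) x]] by simp
          \<comment> \<open>The one-point box specialises the lemmas on boxes to the profile
            \<open>p\<close> alone.\<close>
          have single: "Pi\<^sub>E M (\<lambda>m. {p m}) = {p}"
            using p(1) by (intro PiE_singleton) (simp add: PiE_iff)
          have red': "reduced_to C (\<lambda>m. {p m}) (A - {b}) (B - (\<lambda>_. ?y) ` {b})
              (\<lambda>m. if m \<in> {b} then Some ?y else \<sigma> m)"
            using restricted[OF p(1)] top_b[OF p(1)] True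
            by (intro reduced_to_top_coalition(1)[OF red]) (auto simp: single)
          have fin': "finite (B - {?y})" "B - {?y} \<subseteq> W" using finB AB by auto
          \<comment> \<open>This is where restricting claims to \<open>Wa\<close> pays off:
            \<open>?y\<close> lies outside \<open>Wa\<close>, so \<open>b\<close> cannot have taken
            \<open>?x\<close>.\<close>
          have x': "?x \<in> B - {?y}" using x True by (auto simp: Wa_def)
          have pa: "p a \<in> full_prefs W" using D restricted[OF p(1)] M by blast
          have "best (p a) (B - {?y}) \<in> B"
            using best_in[OF pa fin'] x' by blast
          \<comment> \<open>With \<open>b\<close> gone, every remaining woman ranks \<open>a\<close>
            first among the remaining men.\<close>
          then have "top_coalition (A - {b}) (B - {?y}) p {a}"
            using 2 by (intro top_coalition_singleton) auto
          then have "C p a = Some (best (p a) (B - {?y}))"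
            using reduced_to_top_coalition_member[OF red', of p "{a}" a] single by simp
          then show ?thesis
            unfolding Cp' using x' by (simp only:) (intro best_weakly_prefers[OF pa fin'], auto)
        qed
      qed
    qed
  qed
qed

end

theorem theorem2:
  fixes M :: "'m set" and W :: "'w set" and q :: "'w \<Rightarrow> 'm rel"
  assumes "finite M" and "finite W" and "card M = card W"
    and "q \<in> profiles W M" and "acyclical M W q"
  shows "osp_implementable M W (M_optimal_rule M W q)"
proof -
  interpret acyclical_market M W q
    using assms by unfold_locales
  have "reduced_to (M_optimal_rule M W q) (\<lambda>_. full_prefs W) M W Map.empty"
    using assms(3) by (simp add: reduced_to_def)
  then show ?thesis
    using reduced_toD(3) osp_solvable_if_reduced_to
    by (intro osp_implementable_if_solvable) (auto simp: profiles_def)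
qed

end
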